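(* Consider a space-time DGSEM solution $\{\mathbf U^{n,k}\}_{1\le n\le K_T,\,1\le k\le K_S}$ (as defined in the context) with Dirichlet boundary conditions in time, given by initial nodal data $\mathbf u^{1,k}_{ijk}=\mathbf u^k(0)_{ijk}$, and periodic boundary conditions in space. Assume that: (1) the temporal numerical states are the upwind states $\mathbf U^{*}=\mathbf U_{-}$, i.e. $\mathbf U^{n,k,*}|_{\tau=1}=\mathbf U^{n,k}|_{\tau=1}$ for all $n$, $\mathbf U^{n,k,*}|_{\tau=-1}=\mathbf U^{n-1,k}|_{\tau=1}$ for $n\ge 2$, and $\mathbf U^{1,k,*}|_{\tau=-1}=\mathbf u^{1,k}$, and that they satisfy $[\![\mathbf W]\!]^{T}\mathbf U^{*}\le[\![\Phi]\!]$ at all temporal interfaces; (2) the spatial numerical surface fluxes are $\tilde{\mathbf F}^{*}_{\hat n}=\hat s\left(n_1\mathbf F^{EC}_1+n_2\mathbf F^{EC}_2+n_3\mathbf F^{EC}_3\right)$, where the entropy conservative two-point fluxes $\mathbf F_m^{EC}$ are evaluated at the two states on either side of the spatial interface. Then the space-time DGSEM is entropy stable, i.e. $$\bar S(\mathbf U(T))\le \bar S(\mathbf u(0)),$$ where $$\bar S(\mathbf U(T))=\sum_{k=1}^{K_S}\sum_{i,j,k'=0}^{N}\omega_i\omega_j\omega_{k'}\,J^k_{ijk'}\,s\big(\mathbf U^{K_T,k}_{Mijk'}\big),\qquad \bar S(\mathbf u(0))=\sum_{k=1}^{K_S}\sum_{i,j,k'=0}^{N}\omega_i\omega_j\omega_{k'}\,J^k_{ijk'}\,s\big(\mathbf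 u^{1,k}_{ijk'}\big).$$
   Context: **Conservation law and entropy.** $\partial_t\mathbf u+\sum_{i=1}^3\partial_{x_i}\mathbf f_i(\mathbf u)=0$ is a system of $p$ conservation laws with a strongly convex entropy $s(\mathbf u)$, entropy variables $\mathbf w=\partial s/\partial\mathbf u$, and entropy fluxes $f^s_i$ satisfying $\mathbf w^T\,\partial\mathbf f_i/\partial\mathbf u=(\partial f_i^s/\partial\mathbf u)^T$. Put $\Phi=\mathbf w^T\mathbf u-s$ and $\Psi_i=\mathbf w^T\mathbf f_i-f_i^s$. All states lie in the admissible set, where these functions are defined. **Mesh.** $[0,T]$ is divided into intervals $I_n$ of length $\Delta t^n$, $n=1,\dots,K_T$, each mapped affinely to $\tau\in[-1,1]$. The spatial domain is divided into $K_S$ conforming (possibly curved) hexahedral elements $e_k$, each the image of $E^3=[-1,1]^3$ (coordinates $\xi^1,\xi^2,\xi^3$) under a mapping $\vec\chi=(X_1,X_2,X_3)$. $J$ denotes the nodal values of the polynomial approximation of the Jacobian determinant (positive, time independent). The discrete contravariant vectors $J\vec a^{\,l}=(Ja^l_1,Ja^l_2,Ja^l_3)$, $l=1,2,3$, are $Ja^l_\alpha=-\big[\nabla_\xi\times \mathbb I^N(X_\gamma\nabla_\xi X_\beta)\big]_l$ ($l$-th component of the curl, $(\alpha,\beta,\gamma)$ cyclic, $\mathbb I^N$ the interpolation operator below), and hence satisfy the discrete metric identities $\sum_{l=1}^3\partial_{\xi^l}\mathbb I^N(Ja^l_m)=0$, $m=1,2,3$. On a face of $E^3$ with outward reference unit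 normal $\hat n=(\hat n^1,\hat n^2,\hat n^3)$, the scaled physical normal is $\hat s\vec n=\sum_l \hat n^l J\vec a^{\,l}$, with $\hat s=|\sum_l\hat n^lJ\vec a^{\,l}|$. At each interface the face nodes of the two adjacent elements coincide and $\hat s\vec n$ agrees up to sign. With periodic boundary conditions opposite boundary faces are identified, so that every face is an interface. **Nodes and operators.** Interpolation and quadrature use the Legendre-Gauss-Lobatto (LGL) nodes on $[-1,1]$: $M+1$ nodes $\tau_\sigma$ in time and $N+1$ nodes in each spatial direction, with LGL weights $\omega$ of the respective rule. $\mathcal D_{ij}=\ell_j'(\xi_i)$ is the derivative matrix of the Lagrange basis $\{\ell_j\}$ at the LGL nodes (of degree $M$ in time, $N$ in space). A function with nodal values $\mathbf U_{\sigma ijk}$ ($\sigma=0,\dots,M$; $i,j,k=0,\dots,N$) is a polynomial of degree $M$ in $\tau$ and of tensor degree $N$ in space; $\mathbb I^N$ is spatial tensor LGL interpolation. $\mathbf W$ has nodal values $\mathbf W_{\sigma ijk}=\mathbf w(\mathbf U_{\sigma ijk})$. Write $\omega_{ijk}=\omega_i\omega_j\omega_k$ and $\langle\mathbf F,\mathbf G\rangle_{N\times M}=\sum_{\sigma,i,j,k}\omega_\sigma\omega_{ijk}\mathbf F_{\sigma ijk}^T\mathbf G_{\sigma ijk}$. Write $\langle\mathbf F,\mathbf G\rangle_N|_{\tau=1}=\sum_{ijk}\omega_{ijk}\mathbf F_{Mijk}^T\mathbf G_{Mijk}$, $\langle\mathbf F,\mathbf G\rangle_N|_{\tau=-1}=\sum_{ijk}\omega_{ijk}\mathbf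 F_{0ijk}^T\mathbf G_{0ijk}$, and $\langle\cdot,\cdot\rangle_N|_{-1}^{1}$ for their difference. $\int_{\partial E^3,N}\langle g,1\rangle_M\,dS$ is the sum over the six faces of $E^3$, the face LGL nodes and the time nodes $\sigma$ of $g$ times the product of the two face weights and $\omega_\sigma$. **Two-point functions.** $\mathbf U^\#(\cdot,\cdot)$ is consistent ($\mathbf U^\#(\mathbf a,\mathbf a)=\mathbf a$), symmetric, and satisfies $(\mathbf w(\mathbf a)-\mathbf w(\mathbf b))^T\mathbf U^\#(\mathbf a,\mathbf b)=\Phi(\mathbf a)-\Phi(\mathbf b)$. The $\mathbf F^{EC}_m(\cdot,\cdot)$, $m=1,2,3$, are consistent ($\mathbf F^{EC}_m(\mathbf a,\mathbf a)=\mathbf f_m(\mathbf a)$), symmetric, and satisfy $(\mathbf w(\mathbf a)-\mathbf w(\mathbf b))^T\mathbf F_m^{EC}(\mathbf a,\mathbf b)=\Psi_m(\mathbf a)-\Psi_m(\mathbf b)$. **Derivative projection operators.** $$(\mathbb D^M\mathbf U)_{\sigma ijk}=2\sum_{\theta=0}^M\mathcal D_{\sigma\theta}\mathbf U^\#(\mathbf U_{\sigma ijk},\mathbf U_{\theta ijk}),$$ $$(\mathbb D^N\!\cdot\tilde{\mathbf F}^{EC})_{\sigma ijk}=2\sum_{m=0}^N\sum_{r=1}^3\Big[\mathcal D_{im}\mathbf F_r^{EC}(\mathbf U_{\sigma ijk},\mathbf U_{\sigma mjk})\{\!\{Ja^1_r\}\!\}_{(i,m)jk}+\mathcal D_{jm}\mathbf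 F_r^{EC}(\mathbf U_{\sigma ijk},\mathbf U_{\sigma imk})\{\!\{Ja^2_r\}\!\}_{i(j,m)k}+\mathcal D_{km}\mathbf F_r^{EC}(\mathbf U_{\sigma ijk},\mathbf U_{\sigma ijm})\{\!\{Ja^3_r\}\!\}_{ij(k,m)}\Big],$$ where e.g. $\{\!\{\cdot\}\!\}_{(i,m)jk}=\frac12[(\cdot)_{ijk}+(\cdot)_{mjk}]$. **Scheme.** A space-time DGSEM solution is a family $\mathbf U^{n,k}$ of such polynomials with, for every $(n,k)$ and every vector-valued polynomial test function $\boldsymbol\varphi$ (degree $M$ in time, tensor degree $N$ in space), $A_T(\mathbf U,\boldsymbol\varphi)+A_S(\mathbf F,\boldsymbol\varphi)=0$, where (superscripts $n,k$ suppressed) $$A_T(\mathbf U,\boldsymbol\varphi)=\langle J\,\mathbb D^M\mathbf U,\boldsymbol\varphi\rangle_{N\times M}+\langle J(\mathbf U^*-\mathbf U),\boldsymbol\varphi\rangle_N\big|_{-1}^{1},$$ $$A_S(\mathbf F,\boldsymbol\varphi)=\frac{\Delta t}{2}\langle\mathbb D^N\!\cdot\tilde{\mathbf F}^{EC},\boldsymbol\varphi\rangle_{N\times M}+\frac{\Delta t}{2}\int_{\partial E^3,N}\langle\boldsymbol\varphi^T(\tilde{\mathbf F}^*_{\hat n}-\tilde{\mathbf F}_{\hat n}),1\rangle_M\,dS,$$ with $\tilde{\mathbf F}_{\hat n}=\hat s\sum_m n_m\mathbf f_m(\mathbf U)$ and $\vec n$ pointing out of the element. **Jumps.** $[\![\cdot]\!]=(\cdot)_+-(\cdot)_-$.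 At the temporal interface $\tau=-1$ of element $(n,k)$, $+$ denotes the value in element $(n,k)$ at $\tau=-1$ and $-$ the value in element $(n-1,k)$ at $\tau=1$ (for $n=1$: the initial data $\mathbf u^{1,k}$). *)

theory Defs
  imports "HOL-Analysis.Analysis" "HOL-Computational_Algebra.Polynomial"
begin

text \<open>Legendre polynomials by the formula of Rodrigues.\<close>

definition legendre :: "nat \<Rightarrow> real poly" where
  "legendre N = smult (1 / (2 ^ N * fact N)) ((pderiv ^^ N) ([:- 1, 0, 1:] ^ N))"

text \<open>For N at least 1 the LGL nodes are the N + 1 roots of (1 - x^2) P_N'(x), here numbered from 0
  to N in increasing order.\<close>

definition lgl_node :: "nat \<Rightarrow> nat \<Rightarrow> real" where
  "lgl_node N i =
     sorted_list_of_set {x. poly ([:1, 0, - 1:] * pderiv (legendre N)) x = 0} ! i"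

definition lagrange :: "nat \<Rightarrow> nat \<Rightarrow> real poly" where
  "lagrange N j =
     (\<Prod>i\<in>{..N} - {j}. smult (1 / (lgl_node N j - lgl_node N i)) [:- lgl_node N i, 1:])"

definition lgl_weight :: "nat \<Rightarrow> nat \<Rightarrow> real" where
  "lgl_weight N j = integral {- 1..1} (poly (lagrange N j))"

definition Dmat :: "nat \<Rightarrow> nat \<Rightarrow> nat \<Rightarrow> real" where
  "Dmat N i j = poly (pderiv (lagrange N j)) (lgl_node N i)"

text \<open>Space directions are elements of the numeral type \<^typ>\<open>3\<close>, whose arithmetic is modulo 3:
  for every \<open>a\<close> the triple \<open>(a, a + 1, a + 2)\<close> is cyclic.\<close>

definition strongly_convex_on :: "'a::real_normed_vector set \<Rightarrow> ('a \<Rightarrow> real) \<Rightarrow> bool" where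
  "strongly_convex_on A s \<longleftrightarrow> convex A \<and>
     (\<exists>\<mu>>0. \<forall>x\<in>A. \<forall>y\<in>A. \<forall>t\<in>{0..1}.
        s (t *\<^sub>R x + (1 - t) *\<^sub>R y)
          \<le> t * s x + (1 - t) * s y - \<mu> / 2 * t * (1 - t) * (norm (x - y))\<^sup>2)"

definition entropy_system ::
  "(real^'p) set \<Rightarrow> (3 \<Rightarrow> real^'p \<Rightarrow> real^'p) \<Rightarrow> (real^'p \<Rightarrow> real)
     \<Rightarrow> (real^'p \<Rightarrow> real^'p) \<Rightarrow> (3 \<Rightarrow> real^'p \<Rightarrow> real) \<Rightarrow> bool" where
  "entropy_system A f s w fs \<longleftrightarrow>
     open A \<and> strongly_convex_on A s \<and>
     (\<forall>u\<in>A. GDERIV s u :> w u \<and>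
        (\<forall>i. f i differentiable at u \<and>
             GDERIV (fs i) u :> (w u v* jacobian (f i) (at u))))"

definition Phi :: "(real^'p \<Rightarrow> real) \<Rightarrow> (real^'p \<Rightarrow> real^'p) \<Rightarrow> real^'p \<Rightarrow> real" where
  "Phi s w u = w u \<bullet> u - s u"

definition Psi ::
  "(3 \<Rightarrow> real^'p \<Rightarrow> real^'p) \<Rightarrow> (real^'p \<Rightarrow> real^'p) \<Rightarrow> (3 \<Rightarrow> real^'p \<Rightarrow> real)
     \<Rightarrow> 3 \<Rightarrow> real^'p \<Rightarrow> real" where
  "Psi f w fs i u = w u \<bullet> f i u - fs i u"

text \<open>\<open>two_point A w g \<psi> G\<close>: on the admissible set, \<open>G\<close> is consistent with \<open>g\<close>, symmetric, and
  entropy conservative with potential \<open>\<psi>\<close>.\<close>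

definition two_point ::
  "(real^'p) set \<Rightarrow> (real^'p \<Rightarrow> real^'p) \<Rightarrow> (real^'p \<Rightarrow> real^'p) \<Rightarrow> (real^'p \<Rightarrow> real)
     \<Rightarrow> (real^'p \<Rightarrow> real^'p \<Rightarrow> real^'p) \<Rightarrow> bool" where
  "two_point A w g \<psi> G \<longleftrightarrow>
     (\<forall>a\<in>A. G a a = g a) \<and>
     (\<forall>a\<in>A. \<forall>b\<in>A. G a b = G b a) \<and>
     (\<forall>a\<in>A. \<forall>b\<in>A. (w a - w b) \<bullet> G a b = \<psi> a - \<psi> b)"

type_synonym idx = "nat \<times> nat \<times> nat"

definition E3 :: "(real^3) set" where
  "E3 = cbox (vec (- 1)) (vec 1)"

fun node3 :: "nat \<Rightarrow> idx \<Rightarrow> real^3" where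
  "node3 N (i, j, k) = vector [lgl_node N i, lgl_node N j, lgl_node N k]"

fun weight3 :: "nat \<Rightarrow> idx \<Rightarrow> real" where
  "weight3 N (i, j, k) = lgl_weight N i * lgl_weight N j * lgl_weight N k"

definition idxs :: "nat \<Rightarrow> idx set" where
  "idxs N = {..N} \<times> {..N} \<times> {..N}"

definition interp3 :: "nat \<Rightarrow> (real^3 \<Rightarrow> real) \<Rightarrow> real^3 \<Rightarrow> real" where
  "interp3 N g \<xi> = (\<Sum>(i, j, k)\<in>idxs N. g (node3 N (i, j, k)) *
     poly (lagrange N i) (\<xi> $ 1) * poly (lagrange N j) (\<xi> $ 2) * poly (lagrange N k) (\<xi> $ 3))"

text \<open>Derivatives are taken within \<open>E3\<close>, since the mappings are only defined there.\<close>

definition pd :: "3 \<Rightarrow> (real^3 \<Rightarrow> real) \<Rightarrow> real^3 \<Rightarrow> real" where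
  "pd l g \<xi> = frechet_derivative g (at \<xi> within E3) (axis l 1)"

definition curl :: "(3 \<Rightarrow> real^3 \<Rightarrow> real) \<Rightarrow> 3 \<Rightarrow> real^3 \<Rightarrow> real" where
  "curl V l \<xi> = pd (l + 1) (V (l + 2)) \<xi> - pd (l + 2) (V (l + 1)) \<xi>"

text \<open>Nodal values of the contravariant vectors: \<open>Ja N X l a\<close> is component \<open>a\<close> of the \<open>l\<close>-th vector.\<close>

definition Ja :: "nat \<Rightarrow> (real^3 \<Rightarrow> real^3) \<Rightarrow> 3 \<Rightarrow> 3 \<Rightarrow> idx \<Rightarrow> real" where
  "Ja N X l a q =
     - curl (\<lambda>b. interp3 N (\<lambda>\<eta>. X \<eta> $ (a + 2) * pd b (\<lambda>\<zeta>. X \<zeta> $ (a + 1)) \<eta>)) l (node3 N q)"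

text \<open>Nodal values of the interpolant of the Jacobian determinant.\<close>

definition Jac :: "nat \<Rightarrow> (real^3 \<Rightarrow> real^3) \<Rightarrow> idx \<Rightarrow> real" where
  "Jac N X q = interp3 N (\<lambda>\<xi>. det (jacobian X (at \<xi> within E3))) (node3 N q)"

text \<open>The face \<open>(l, True)\<close> is the part of the boundary of \<open>E3\<close> where coordinate \<open>l\<close> equals 1, and
  \<open>(l, False)\<close> the part where it equals -1.\<close>

type_synonym face = "3 \<times> bool"

definition face_set :: "face \<Rightarrow> (real^3) set" where
  "face_set F = {\<xi>\<in>E3. \<xi> $ fst F = (if snd F then 1 else - 1)}"

definition face_node :: "nat \<Rightarrow> face \<Rightarrow> nat \<times> nat \<Rightarrow> idx" where
  "face_node N F ab =
     (let e = (if snd F then N else 0); (a, b) = ab in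
      if fst F = 1 then (e, a, b) else if fst F = 2 then (a, e, b) else (a, b, e))"

definition nhat :: "face \<Rightarrow> real^3" where
  "nhat F = axis (fst F) (if snd F then 1 else - 1)"

text \<open>\<open>scaled_normal\<close> is the vector \<open>\<Sum>\<^sub>l nhat\<^sup>l Ja\<^sup>l\<close>, \<open>shat\<close> its length and \<open>unit_normal\<close> its direction.\<close>

definition scaled_normal :: "nat \<Rightarrow> (real^3 \<Rightarrow> real^3) \<Rightarrow> face \<Rightarrow> idx \<Rightarrow> real^3" where
  "scaled_normal N X F q = (\<chi> m. \<Sum>l\<in>UNIV. nhat F $ l * Ja N X l m q)"

definition shat :: "nat \<Rightarrow> (real^3 \<Rightarrow> real^3) \<Rightarrow> face \<Rightarrow> idx \<Rightarrow> real" where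
  "shat N X F q = norm (scaled_normal N X F q)"

definition unit_normal :: "nat \<Rightarrow> (real^3 \<Rightarrow> real^3) \<Rightarrow> face \<Rightarrow> idx \<Rightarrow> real^3" where
  "unit_normal N X F q = scaled_normal N X F q /\<^sub>R shat N X F q"

text \<open>Two elements sharing a face may parametrize it differently, by a symmetry of the square
  \<open>[-1,1]\<^sup>2\<close>: an optional swap of the two coordinates followed by optional reflections. This is its
  action on node indices; reflection is \<open>a \<mapsto> N - a\<close> because the LGL nodes are symmetric.\<close>

type_synonym square_sym = "bool \<times> bool \<times> bool"

fun sym_act :: "nat \<Rightarrow> square_sym \<Rightarrow> nat \<times> nat \<Rightarrow> nat \<times> nat" where
  "sym_act N (sw, r1, r2) (a, b) =
     (let (c, d) = (if sw then (b, a) else (a, b))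
      in (if r1 then N - c else c, if r2 then N - d else d))"

text \<open>A side \<open>(k, F)\<close> is face \<open>F\<close> of element \<open>k\<close>; \<open>nb\<close> maps it to the side it is identified with
  and \<open>orient\<close> gives the transformation of the face nodes. With periodic boundary conditions every
  side has a partner; the vector \<open>shift\<close> is zero at interior interfaces and is the period that
  carries a boundary face to the opposite one. Since normals point out of their own element,
  agreement up to sign means that the two scaled normals at an interface node are opposite.\<close>

definition matched_sides ::
  "nat \<Rightarrow> (real^3) set \<Rightarrow> (nat \<Rightarrow> real^3 \<Rightarrow> real^3)
     \<Rightarrow> square_sym \<Rightarrow> real^3 \<Rightarrow> nat \<times> face \<Rightarrow> nat \<times> face \<Rightarrow> bool" where
  "matched_sides N \<Omega> X g v K K' \<longleftrightarrow>
     (v = 0 \<or> X (fst K) ` face_set (snd K) \<subseteq> frontier \<Omega>) \<and>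
     (\<lambda>x. x + v) ` X (fst K) ` face_set (snd K) = X (fst K') ` face_set (snd K') \<and>
     (\<forall>a\<le>N. \<forall>b\<le>N.
        let q = face_node N (snd K) (a, b);
            q' = face_node N (snd K') (sym_act N g (a, b))
        in X (fst K) (node3 N q) + v = X (fst K') (node3 N q') \<and>
           scaled_normal N (X (fst K')) (snd K') q' = - scaled_normal N (X (fst K)) (snd K) q)"

definition periodic_mesh ::
  "nat \<Rightarrow> (real^3) set \<Rightarrow> nat \<Rightarrow> (nat \<Rightarrow> real^3 \<Rightarrow> real^3) \<Rightarrow> (nat \<times> face \<Rightarrow> nat \<times> face)
     \<Rightarrow> (nat \<times> face \<Rightarrow> square_sym) \<Rightarrow> (nat \<times> face \<Rightarrow> real^3) \<Rightarrow> bool" where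
  "periodic_mesh N \<Omega> KS X nb orient shift \<longleftrightarrow>
     (\<forall>k\<in>{1..KS}. X k differentiable_on E3 \<and> (\<forall>q\<in>idxs N. Jac N (X k) q > 0)) \<and>
     \<Omega> = (\<Union>k\<in>{1..KS}. X k ` E3) \<and>
     (\<forall>k\<in>{1..KS}. \<forall>k'\<in>{1..KS}. k \<noteq> k' \<longrightarrow> interior (X k ` E3) \<inter> interior (X k' ` E3) = {}) \<and>
     (\<forall>K\<in>{1..KS} \<times> UNIV.
        nb K \<in> {1..KS} \<times> UNIV \<and> nb K \<noteq> K \<and> nb (nb K) = K \<and> shift (nb K) = - shift K \<and>
        (\<forall>a\<le>N. \<forall>b\<le>N. sym_act N (orient (nb K)) (sym_act N (orient K) (a, b)) = (a, b)) \<and>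
        matched_sides N \<Omega> X (orient K) (shift K) K (nb K))"

text \<open>Breakpoints \<open>0 = t 0 < \<dots> < t KT = T\<close>; the \<open>n\<close>-th time interval is \<open>{t (n - 1)..t n}\<close>.\<close>

definition time_mesh :: "real \<Rightarrow> nat \<Rightarrow> (nat \<Rightarrow> real) \<Rightarrow> bool" where
  "time_mesh T KT t \<longleftrightarrow> t 0 = 0 \<and> t KT = T \<and> (\<forall>n\<in>{1..KT}. t (n - 1) < t n)"

text \<open>A polynomial of degree \<open>M\<close> in time and tensor degree \<open>N\<close> in space is represented by its nodal
  values \<open>U \<sigma> q\<close>, for \<open>\<sigma> \<le> M\<close> and \<open>q \<in> idxs N\<close>; other values are never used.\<close>

type_synonym 'p space_field = "idx \<Rightarrow> real^'p"
type_synonym 'p st_field = "nat \<Rightarrow> idx \<Rightarrow> real^'p"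

definition DM ::
  "nat \<Rightarrow> (real^'p \<Rightarrow> real^'p \<Rightarrow> real^'p) \<Rightarrow> 'p st_field \<Rightarrow> 'p st_field" where
  "DM M Us U \<sigma> q = 2 *\<^sub>R (\<Sum>\<theta>\<le>M. Dmat M \<sigma> \<theta> *\<^sub>R Us (U \<sigma> q) (U \<theta> q))"

fun DN ::
  "nat \<Rightarrow> (real^3 \<Rightarrow> real^3) \<Rightarrow> (3 \<Rightarrow> real^'p \<Rightarrow> real^'p \<Rightarrow> real^'p) \<Rightarrow> 'p st_field \<Rightarrow> 'p st_field" where
  "DN N X FEC U \<sigma> (i, j, k) = 2 *\<^sub>R (\<Sum>m\<le>N. \<Sum>r\<in>UNIV.
     (Dmat N i m * ((Ja N X 1 r (i, j, k) + Ja N X 1 r (m, j, k)) / 2))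
       *\<^sub>R FEC r (U \<sigma> (i, j, k)) (U \<sigma> (m, j, k)) +
     (Dmat N j m * ((Ja N X 2 r (i, j, k) + Ja N X 2 r (i, m, k)) / 2))
       *\<^sub>R FEC r (U \<sigma> (i, j, k)) (U \<sigma> (i, m, k)) +
     (Dmat N k m * ((Ja N X 3 r (i, j, k) + Ja N X 3 r (i, j, m)) / 2))
       *\<^sub>R FEC r (U \<sigma> (i, j, k)) (U \<sigma> (i, j, m)))"

definition inner_N :: "nat \<Rightarrow> ('p::finite) space_field \<Rightarrow> 'p space_field \<Rightarrow> real" where
  "inner_N N F G = (\<Sum>q\<in>idxs N. weight3 N q * (F q \<bullet> G q))"

definition inner_NM :: "nat \<Rightarrow> nat \<Rightarrow> ('p::finite) st_field \<Rightarrow> 'p st_field \<Rightarrow> real" where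
  "inner_NM N M F G = (\<Sum>\<sigma>\<le>M. lgl_weight M \<sigma> * inner_N N (F \<sigma>) (G \<sigma>))"

definition face_integral :: "nat \<Rightarrow> nat \<Rightarrow> (face \<Rightarrow> nat \<Rightarrow> nat \<times> nat \<Rightarrow> real) \<Rightarrow> real" where
  "face_integral N M g = (\<Sum>F\<in>UNIV. \<Sum>a\<le>N. \<Sum>b\<le>N. \<Sum>\<sigma>\<le>M.
     lgl_weight N a * lgl_weight N b * lgl_weight M \<sigma> * g F \<sigma> (a, b))"

text \<open>\<open>UL\<close> and \<open>UR\<close> are the numerical states at \<open>\<tau> = -1\<close> and \<open>\<tau> = 1\<close>.\<close>

definition A_T ::
  "nat \<Rightarrow> nat \<Rightarrow> (idx \<Rightarrow> real) \<Rightarrow> (real^'p \<Rightarrow> real^'p \<Rightarrow> real^'p)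
     \<Rightarrow> 'p space_field \<Rightarrow> 'p space_field \<Rightarrow> 'p st_field \<Rightarrow> 'p st_field \<Rightarrow> real" where
  "A_T N M J Us UL UR U \<phi> =
     inner_NM N M (\<lambda>\<sigma> q. J q *\<^sub>R DM M Us U \<sigma> q) \<phi>
     + (inner_N N (\<lambda>q. J q *\<^sub>R (UR q - U M q)) (\<phi> M)
        - inner_N N (\<lambda>q. J q *\<^sub>R (UL q - U 0 q)) (\<phi> 0))"

definition normal_flux ::
  "nat \<Rightarrow> (real^3 \<Rightarrow> real^3) \<Rightarrow> face \<Rightarrow> idx \<Rightarrow> (3 \<Rightarrow> real^'p) \<Rightarrow> real^'p" where
  "normal_flux N X F q h =
     shat N X F q *\<^sub>R (\<Sum>m\<in>UNIV. (unit_normal N X F q $ m) *\<^sub>R h m)"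

definition A_S ::
  "nat \<Rightarrow> nat \<Rightarrow> (real^3 \<Rightarrow> real^3) \<Rightarrow> real \<Rightarrow> (3 \<Rightarrow> real^'p \<Rightarrow> real^'p)
     \<Rightarrow> (3 \<Rightarrow> real^'p \<Rightarrow> real^'p \<Rightarrow> real^'p)
     \<Rightarrow> (face \<Rightarrow> nat \<Rightarrow> nat \<times> nat \<Rightarrow> real^'p) \<Rightarrow> 'p st_field \<Rightarrow> 'p st_field \<Rightarrow> real" where
  "A_S N M X dt f FEC Fstar U \<phi> =
     dt / 2 * inner_NM N M (DN N X FEC U) \<phi>
     + dt / 2 * face_integral N M (\<lambda>F \<sigma> ab. let q = face_node N F ab in
         \<phi> \<sigma> q \<bullet> (Fstar F \<sigma> ab - normal_flux N X F q (\<lambda>m. f m (U \<sigma> q))))"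

text \<open>In the following, \<open>U n k\<close> is the solution in the space-time element \<open>(n, k)\<close>, \<open>UL n k\<close> and
  \<open>UR n k\<close> are its temporal numerical states, \<open>Fstar n k\<close> its numerical surface fluxes, and
  \<open>u0 k\<close> the initial nodal data.\<close>

definition dgsem_solution ::
  "nat \<Rightarrow> nat \<Rightarrow> nat \<Rightarrow> nat \<Rightarrow> (nat \<Rightarrow> real) \<Rightarrow> (nat \<Rightarrow> real^3 \<Rightarrow> real^3)
     \<Rightarrow> (3 \<Rightarrow> real^'p \<Rightarrow> real^'p) \<Rightarrow> (real^'p \<Rightarrow> real^'p \<Rightarrow> real^'p)
     \<Rightarrow> (3 \<Rightarrow> real^'p \<Rightarrow> real^'p \<Rightarrow> real^'p)
     \<Rightarrow> (nat \<Rightarrow> nat \<Rightarrow> 'p space_field) \<Rightarrow> (nat \<Rightarrow> nat \<Rightarrow> 'p space_field)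
     \<Rightarrow> (nat \<Rightarrow> nat \<Rightarrow> face \<Rightarrow> nat \<Rightarrow> nat \<times> nat \<Rightarrow> real^'p) \<Rightarrow> (nat \<Rightarrow> nat \<Rightarrow> 'p st_field) \<Rightarrow> bool" where
  "dgsem_solution N M KT KS t X f Us FEC UL UR Fstar U \<longleftrightarrow>
     (\<forall>n\<in>{1..KT}. \<forall>k\<in>{1..KS}. \<forall>\<phi>.
        A_T N M (Jac N (X k)) Us (UL n k) (UR n k) (U n k) \<phi>
        + A_S N M (X k) (t n - t (n - 1)) f FEC (Fstar n k) (U n k) \<phi> = 0)"

text \<open>The value on the minus side of the temporal interface at \<open>\<tau> = -1\<close> of element \<open>(n, k)\<close>.\<close>

definition past_state ::
  "nat \<Rightarrow> (nat \<Rightarrow> 'p space_field) \<Rightarrow> (nat \<Rightarrow> nat \<Rightarrow> 'p st_field) \<Rightarrow> nat \<Rightarrow> nat \<Rightarrow> 'p space_field" where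
  "past_state M u0 U n k = (if n = 1 then u0 k else U (n - 1) k M)"

text \<open>The value on the other side of the spatial interface, at a node of face \<open>F\<close> of element \<open>k\<close>.\<close>

definition outer_state ::
  "nat \<Rightarrow> (nat \<times> face \<Rightarrow> nat \<times> face) \<Rightarrow> (nat \<times> face \<Rightarrow> square_sym)
     \<Rightarrow> (nat \<Rightarrow> nat \<Rightarrow> 'p st_field) \<Rightarrow> nat \<Rightarrow> nat \<Rightarrow> face \<Rightarrow> nat \<Rightarrow> nat \<times> nat \<Rightarrow> real^'p" where
  "outer_state N nb orient U n k F \<sigma> ab =
     U n (fst (nb (k, F))) \<sigma> (face_node N (snd (nb (k, F))) (sym_act N (orient (k, F)) ab))"

definition total_entropy ::
  "nat \<Rightarrow> nat \<Rightarrow> (nat \<Rightarrow> real^3 \<Rightarrow> real^3) \<Rightarrow> (real^'p \<Rightarrow> real) \<Rightarrow> (nat \<Rightarrow> 'p space_field) \<Rightarrow> real" where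
  "total_entropy N KS X s V =
     (\<Sum>k=1..KS. \<Sum>q\<in>idxs N. weight3 N q * Jac N (X k) q * s (V k q))"

end

theory Submission
  imports Defs
begin

text \<open>The discrete entropy is controlled by testing the scheme with the entropy variables
  \<open>W = w(U)\<close> and by showing that every term in the resulting identity collapses to differences of
  values at the two ends of a time interval or at interfaces.

  The mechanism is one-dimensional. Legendre-Gauss-Lobatto quadrature with \<open>N + 1\<close> nodes is exact up
  to degree \<open>2 N - 1\<close>, and products of a Lagrange basis polynomial with the derivative of another have
  at most that degree. Hence the matrix with entries \<open>\<omega>\<^sub>i D\<^sub>i\<^sub>j\<close> is skew-symmetric up to the two
  boundary entries (\<open>lgl_summation_by_parts\<close>). A two-point function that satisfies
  \<open>(w(a) - w(b)) \<bullet> G(a, b) = \<psi>(a) - \<psi>(b)\<close> makes \<open>w(a) \<bullet> G(a, b) - \<psi>(a)\<close> symmetric in \<open>a\<close> and \<open>b\<close>.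
  Pairing a symmetric array with a matrix that is almost skew leaves only the boundary entries; the
  potential \<open>\<psi>\<close> that was subtracted contributes the derivative of the metric coefficient
  (\<open>sum_by_parts_two_point\<close>).

  In time the coefficient is constant, and since \<open>w \<bullet> u - \<Phi> = s\<close> what is left is \<open>s\<close> at the end minus
  \<open>s\<close> at the start of the interval, together with the upwind coupling to the previous interval
  (\<open>A_T_entropy\<close>). In space the contributions of \<open>\<psi>\<close> add up over the three directions to a multiple
  of the divergence of the contravariant vectors, which vanishes because these are a discrete curl and
  the nodal derivatives in different directions commute (\<open>discrete_metric_identities\<close>). What remains
  lives on the faces (\<open>volume_entropy_balance\<close>). The numerical surface flux replaces the flux of one
  state by the two-point flux of both, and so the contributions of the two sides of an interface cancel:
  the normals are opposite, and the same symmetry as above identifies the other factors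
  (\<open>interface_sum_zero\<close>).

  Consequently the temporal parts sum to zero over the elements of one time slab. The condition on the
  temporal jumps, weighted by the Jacobian and by quadrature weights, which are nonnegative
  (\<open>lgl_weight_nonneg\<close>), then says that the entropy does not increase from one slab to the next.\<close>

section \<open>The Legendre-Gauss-Lobatto nodes\<close>

text \<open>Rolle's theorem between consecutive zeros. The induction removes the largest zero \<open>x\<close>, so that the
  zeros of the derivative already found stay to the left of the second largest zero \<open>y\<close>, and adds the
  one between \<open>y\<close> and \<open>x\<close>.\<close>

lemma finite_set_Rolle_poly:
  fixes p :: "real poly"
  assumes "finite S" "card S = Suc m" "S \<subseteq> {a..b}" "\<And>x. x \<in> S \<Longrightarrow> poly p x = 0"
  shows "\<exists>R. finite R \<and> card R = m \<and> R \<subseteq> {a<..<b} \<and> (\<forall>x\<in>R. poly (pderiv p) x = 0)"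
  using assms
proof (induction m arbitrary: S b)
  case 0
  show ?case by (rule exI[of _ "{}"]) simp
next
  case (Suc m)
  define x where "x = Max S"
  define S' where "S' = S - {x}"
  have S: "S \<noteq> {}" using Suc.prems by auto
  have xS: "x \<in> S" using S Suc.prems(1) by (simp add: x_def)
  have fin: "finite S'" and card: "card S' = Suc m"
    using Suc.prems xS by (auto simp: S'_def)
  define y where "y = Max S'"
  have ne: "S' \<noteq> {}" using card by auto
  have yS: "y \<in> S'" using ne fin by (simp add: y_def)
  have yx: "y < x"
  proof -
    have "y \<le> x" using yS Suc.prems(1) by (auto simp: S'_def x_def)
    thus ?thesis using yS by (auto simp: S'_def)
  qed
  have "S' \<subseteq> {a..y}"
  proof
    fix z assume "z \<in> S'"
    moreover from this have "z \<in> {a..b}" using Suc.prems(3) by (auto simp: S'_def)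
    ultimately show "z \<in> {a..y}" using fin by (simp add: y_def)
  qed
  then obtain R where R: "finite R" "card R = m" "R \<subseteq> {a<..<y}"
      "\<forall>x\<in>R. poly (pderiv p) x = 0"
    using Suc.IH[OF fin card, of y] Suc.prems(4) by (auto simp: S'_def)
  obtain z where z: "y < z" "z < x" "poly (pderiv p) z = 0"
  proof -
    have "poly p y = 0" "poly p x = 0" using Suc.prems(4) yS xS by (auto simp: S'_def)
    thus ?thesis using poly_MVT[OF yx, of p] yx that by auto
  qed
  have "a \<le> y" "x \<le> b" using yS xS Suc.prems(3) by (auto simp: S'_def)
  moreover have "z \<notin> R" using R z by auto
  ultimately show ?case
    using R z by (intro exI[of _ "insert z R"]) (auto dest: subsetD)
qed

text \<open>Differentiation lowers the multiplicity of a factor by at most one.\<close>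

lemma power_dvd_pderiv:
  fixes p q :: "real poly"
  assumes "q ^ Suc m dvd p"
  shows "q ^ m dvd pderiv p"
proof -
  obtain r where "p = q ^ Suc m * r" using assms by (elim dvdE)
  hence "pderiv p = q ^ Suc m * pderiv r + r * (smult (of_nat (Suc m)) (q ^ m) * pderiv q)"
    by (simp only: pderiv_mult pderiv_power_Suc)
  moreover have "q ^ m dvd q ^ Suc m * pderiv r"
    by (intro dvd_mult2 le_imp_power_dvd) simp
  moreover have "q ^ m dvd r * (smult (of_nat (Suc m)) (q ^ m) * pderiv q)"
    by (intro dvd_mult dvd_mult2 dvd_smult dvd_refl)
  ultimately show ?thesis by simp
qed

lemma dvd_rodrigues:
  assumes "k \<le> N"
  shows "[:- 1, 0, 1:] ^ (N - k) dvd (pderiv ^^ k) ([:- 1, 0, 1 :: real:] ^ N)"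
  using assms
proof (induction k)
  case (Suc k)
  hence "[:- 1, 0, 1:] ^ Suc (N - Suc k) dvd (pderiv ^^ k) ([:- 1, 0, 1 :: real:] ^ N)"
    by (simp add: Suc_diff_Suc del: power_Suc)
  thus ?case using power_dvd_pderiv by simp
qed simp

lemma rodrigues_endpoints:
  assumes "k < N" "x\<^sup>2 = (1::real)"
  shows "poly ((pderiv ^^ k) ([:- 1, 0, 1:] ^ N)) x = 0"
proof -
  have "[:- 1, 0, 1:] dvd ([:- 1, 0, 1 :: real:] ^ (N - k))"
    using assms by (simp add: dvd_power)
  hence "[:- 1, 0, 1:] dvd (pderiv ^^ k) ([:- 1, 0, 1 :: real:] ^ N)"
    using dvd_rodrigues[of k N] assms dvd_trans by auto
  then obtain r where "(pderiv ^^ k) ([:- 1, 0, 1 :: real:] ^ N) = [:- 1, 0, 1:] * r"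
    by (elim dvdE)
  thus ?thesis using assms by (simp add: power2_eq_square)
qed

text \<open>Each differentiation of \<open>(x\<^sup>2 - 1)\<^sup>N\<close> gains one zero inside the interval: as long as fewer than
  \<open>N\<close> derivatives were taken, both end points are zeros too, so \<open>k\<close> interior zeros give \<open>k + 2\<close> zeros
  for Rolle's theorem.\<close>

lemma rodrigues_roots:
  assumes "k \<le> N"
  shows "\<exists>R. finite R \<and> card R = k \<and> R \<subseteq> {- 1<..<1} \<and>
    (\<forall>x\<in>R. poly ((pderiv ^^ k) ([:- 1, 0, 1 :: real:] ^ N)) x = 0)"
  using assms
proof (induction k)
  case 0
  show ?case by (rule exI[of _ "{}"]) simp
next
  case (Suc k)
  then obtain R where R: "finite R" "card R = k" "R \<subseteq> {- 1<..<1}"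
    "\<forall>x\<in>R. poly ((pderiv ^^ k) ([:- 1, 0, 1 :: real:] ^ N)) x = 0" by auto
  have "- 1 \<notin> R" "1 \<notin> R" using R(3) by auto
  hence "card ({- 1, 1} \<union> R) = Suc (Suc k)" using R by simp
  moreover have "poly ((pderiv ^^ k) ([:- 1, 0, 1 :: real:] ^ N)) x = 0" if "x \<in> {- 1, 1} \<union> R" for x
    using that R(4) rodrigues_endpoints[of k N x] Suc.prems by auto
  moreover have "{- 1, 1} \<union> R \<subseteq> {- 1..1}" using R(3) by auto
  ultimately show ?case
    using finite_set_Rolle_poly[of "{- 1, 1} \<union> R" "Suc k" "- 1" 1] R(1) by simp
qed

lemma degree_higher_pderiv: "degree ((pderiv ^^ k) (p :: real poly)) = degree p - k"
  by (induction k) (auto simp: degree_pderiv)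

lemma degree_legendre: "degree (legendre N) = N"
  by (simp add: legendre_def degree_higher_pderiv degree_power_eq)

definition lgl_poly :: "nat \<Rightarrow> real poly" where
  "lgl_poly N = [:1, 0, - 1:] * pderiv (legendre N)"

lemma degree_lgl_poly:
  assumes "N \<ge> 1"
  shows "lgl_poly N \<noteq> 0" "degree (lgl_poly N) = Suc N"
proof -
  have "pderiv (legendre N) \<noteq> 0" using assms by (simp add: pderiv_eq_0_iff degree_legendre)
  thus "lgl_poly N \<noteq> 0" "degree (lgl_poly N) = Suc N"
    using assms unfolding lgl_poly_def
    by (auto simp: degree_mult_eq degree_pderiv degree_legendre simp del: mult_pCons_left)
qed

definition lgl_set :: "nat \<Rightarrow> real set" where
  "lgl_set N = {x. poly (lgl_poly N) x = 0}"

lemma lgl_node_eq: "lgl_node N i = sorted_list_of_set (lgl_set N) ! i"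
  by (simp only: lgl_node_def lgl_set_def lgl_poly_def)

text \<open>The interior zeros found by Rolle's theorem, together with the end points, exhaust the degree of the
  polynomial, so there are no other zeros. Only for this reason does the sorted list behind \<open>lgl_node\<close> have an entry at every
  index up to \<open>N\<close>, and the end points of the interval at its two ends.\<close>

lemma lgl_set_props:
  assumes "N \<ge> 1"
  shows "finite (lgl_set N)" "card (lgl_set N) = Suc N" "lgl_set N \<subseteq> {- 1..1}"
    "- 1 \<in> lgl_set N" "1 \<in> lgl_set N"
proof -
  show fin: "finite (lgl_set N)"
    unfolding lgl_set_def by (rule poly_roots_finite) (rule degree_lgl_poly[OF assms])
  show ends: "- 1 \<in> lgl_set N" "1 \<in> lgl_set N"
    by (simp_all add: lgl_set_def lgl_poly_def)
  obtain R where R: "finite R" "card R = Suc (N - 1)" "R \<subseteq> {- 1<..<1}"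
    "\<forall>x\<in>R. poly (legendre N) x = 0"
    using rodrigues_roots[of N N] assms by (auto simp: legendre_def)
  have "R \<subseteq> {- 1..1}" using R(3) by auto
  then obtain R' where R': "finite R'" "card R' = N - 1" "R' \<subseteq> {- 1<..<1}"
    "\<forall>x\<in>R'. poly (pderiv (legendre N)) x = 0"
    using finite_set_Rolle_poly[OF R(1,2), of "- 1" 1 "legendre N"] R(4) by blast
  have "- 1 \<notin> R'" "1 \<notin> R'" using R'(3) by auto
  hence card: "card ({- 1, 1} \<union> R') = Suc N" using R' assms by simp
  have sub: "{- 1, 1} \<union> R' \<subseteq> lgl_set N"
    using R' ends by (auto simp: lgl_set_def lgl_poly_def)
  have "card (lgl_set N) \<le> Suc N"
    unfolding lgl_set_def using card_poly_roots_bound degree_lgl_poly[OF assms] by metis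
  hence eq: "{- 1, 1} \<union> R' = lgl_set N"
    using card fin sub by (metis card_seteq)
  show "card (lgl_set N) = Suc N" using card eq by simp
  have "{- 1, 1} \<union> R' \<subseteq> {- 1..1}" using R'(3) by auto
  thus "lgl_set N \<subseteq> {- 1..1}" by (simp only: eq)
qed

lemma lgl_list_props:
  assumes "N \<ge> 1"
  shows "length (sorted_list_of_set (lgl_set N)) = Suc N"
    "set (sorted_list_of_set (lgl_set N)) = lgl_set N"
  using lgl_set_props[OF assms] by simp_all

lemma lgl_nodes:
  assumes "N \<ge> 1"
  shows "lgl_node N ` {..N} = lgl_set N" "inj_on (lgl_node N) {..N}"
    "lgl_node N 0 = - 1" "lgl_node N N = 1"
proof -
  let ?l = "sorted_list_of_set (lgl_set N)"
  note P = lgl_set_props[OF assms] and L = lgl_list_props[OF assms]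
  have "set ?l = (\<lambda>i. ?l ! i) ` {..N}"
    using L(1) by (auto simp: set_conv_nth image_def less_Suc_eq_le)
  thus im: "lgl_node N ` {..N} = lgl_set N"
    using L(2) by (simp add: lgl_node_eq image_def)
  show "inj_on (lgl_node N) {..N}"
    using im P by (intro eq_card_imp_inj_on) auto
  have mono: "lgl_node N i \<le> lgl_node N j" if "i \<le> j" "j \<le> N" for i j
    using that L(1) by (simp add: lgl_node_eq sorted_nth_mono)
  obtain i j where "i \<le> N" "lgl_node N i = - 1" "j \<le> N" "lgl_node N j = 1"
    using P(4,5) im by (metis atMost_iff imageE)
  moreover have "lgl_node N 0 \<in> {- 1..1}" "lgl_node N N \<in> {- 1..1}"
    using im P(3) by blast+
  ultimately show "lgl_node N 0 = - 1" "lgl_node N N = 1"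
    using mono[of 0 i] mono[of j N] by auto
qed

lemma lgl_node_eq_iff:
  assumes "N \<ge> 1" "i \<le> N" "j \<le> N"
  shows "lgl_node N i = lgl_node N j \<longleftrightarrow> i = j"
  using lgl_nodes(2)[OF assms(1)] assms by (auto simp: inj_on_def)

lemma lgl_node_bounds:
  assumes "N \<ge> 1" "i \<le> N"
  shows "- 1 \<le> lgl_node N i" "lgl_node N i \<le> 1"
proof -
  have "lgl_node N i \<in> {- 1..1}"
    using lgl_nodes(1)[OF assms(1)] lgl_set_props(3)[OF assms(1)] assms(2) by blast
  thus "- 1 \<le> lgl_node N i" "lgl_node N i \<le> 1" by simp_all
qed

text \<open>Differentiation exchanges even and odd functions. Through the formula of Rodrigues this makes the
  set of nodes symmetric about 0.\<close>

lemma poly_higher_pderiv_neg: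
  fixes p :: "real poly"
  assumes "\<And>x. poly p (- x) = poly p x"
  shows "poly ((pderiv ^^ k) p) (- x) = (- 1) ^ k * poly ((pderiv ^^ k) p) x"
proof -
  have "pcompose ((pderiv ^^ k) p) [:0, - 1:] = smult ((- 1) ^ k) ((pderiv ^^ k) p)"
  proof (induction k)
    case 0
    show ?case using assms by (intro poly_eq_poly_eq_iff[THEN iffD1]) (simp add: fun_eq_iff poly_pcompose)
  next
    case (Suc k)
    have "smult (- 1) (pcompose (pderiv ((pderiv ^^ k) p)) [:0, - 1:])
      = pderiv (pcompose ((pderiv ^^ k) p) [:0, - 1:])"
      by (simp add: pderiv_pcompose pderiv_pCons)
    also have "\<dots> = smult ((- 1) ^ k) (pderiv ((pderiv ^^ k) p))"
      by (simp add: Suc.IH pderiv_smult)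
    finally have "smult (- 1) (smult (- 1) (pcompose (pderiv ((pderiv ^^ k) p)) [:0, - 1:]))
      = smult (- 1) (smult ((- 1) ^ k) (pderiv ((pderiv ^^ k) p)))" by (rule arg_cong)
    thus ?case by simp
  qed
  from arg_cong[OF this, of "\<lambda>q. poly q x"] show ?thesis by (simp add: poly_pcompose)
qed

lemma uminus_lgl_set:
  assumes "x \<in> lgl_set N"
  shows "- x \<in> lgl_set N"
proof -
  have "pderiv (legendre N) = smult (1 / (2 ^ N * fact N)) ((pderiv ^^ Suc N) ([:- 1, 0, 1:] ^ N))"
    by (simp add: legendre_def pderiv_smult)
  moreover have "poly ((pderiv ^^ Suc N) ([:- 1, 0, 1:] ^ N)) (- x) =
      (- 1) ^ Suc N * poly ((pderiv ^^ Suc N) ([:- 1, 0, 1:] ^ N)) x"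
    by (rule poly_higher_pderiv_neg) (simp add: poly_power)
  ultimately show ?thesis using assms by (simp add: lgl_set_def lgl_poly_def del: funpow.simps)
qed

text \<open>Negation reverses the order of the nodes, so the negated reversed list is again the sorted list of
  nodes.\<close>

lemma lgl_node_reflect:
  assumes "N \<ge> 1" "i \<le> N"
  shows "lgl_node N (N - i) = - lgl_node N i"
proof -
  let ?l = "sorted_list_of_set (lgl_set N)"
  note P = lgl_set_props[OF assms(1)] and L = lgl_list_props[OF assms(1)]
  let ?r = "map uminus (rev ?l)"
  have "sorted ?r"
    by (simp add: sorted_map sorted_wrt_rev)
  moreover have "distinct ?r" by (simp add: distinct_map)
  moreover have "set ?r = lgl_set N"
    using uminus_lgl_set[of _ N] L(2) by (auto simp: image_iff) (metis add.inverse_inverse)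
  ultimately have "?l = ?r"
    by (intro sorted_distinct_set_unique) (use L in auto)
  hence "?l ! (N - i) = ?r ! (N - i)" by simp
  also have "\<dots> = - ?l ! i" using L(1) assms(2) by (simp add: rev_nth)
  finally show ?thesis by (simp add: lgl_node_eq)
qed

section \<open>Legendre-Gauss-Lobatto quadrature and summation by parts\<close>

lemma degree_lagrange:
  assumes "j \<le> N"
  shows "degree (lagrange N j) \<le> N"
proof -
  have "degree (lagrange N j) \<le>
      (\<Sum>i\<in>{..N} - {j}. degree (smult (1 / (lgl_node N j - lgl_node N i)) [:- lgl_node N i, 1:]))"
    unfolding lagrange_def by (rule degree_prod_sum_le[unfolded comp_def]) simp
  also have "\<dots> \<le> (\<Sum>i\<in>{..N} - {j}. 1)"
    by (intro sum_mono) (simp add: order_trans[OF degree_smult_le])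
  also have "\<dots> = N" using assms by simp
  finally show ?thesis .
qed

lemma poly_lagrange_node:
  assumes "N \<ge> 1" "i \<le> N" "j \<le> N"
  shows "poly (lagrange N j) (lgl_node N i) = (if i = j then 1 else 0)"
proof (cases "i = j")
  case True
  have "poly (smult (1 / (lgl_node N j - lgl_node N m)) [:- lgl_node N m, 1:]) (lgl_node N j) = 1"
    if "m \<in> {..N} - {j}" for m
    using that assms lgl_node_eq_iff[of N j m] by (simp flip: diff_divide_distrib)
  thus ?thesis using True by (simp add: lagrange_def poly_prod prod.neutral del: poly_smult)
next
  case False
  thus ?thesis using assms by (auto simp: lagrange_def poly_prod)
qed

lemma lagrange_interpolation:
  assumes "N \<ge> 1" "degree p \<le> N"
  shows "p = (\<Sum>j\<le>N. smult (poly p (lgl_node N j)) (lagrange N j))"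
proof (rule poly_eqI_degree[where A = "lgl_node N ` {..N}"])
  have card: "card (lgl_node N ` {..N}) = Suc N"
    using lgl_nodes(2)[OF assms(1)] by (simp add: card_image)
  show "degree p < card (lgl_node N ` {..N})" using assms(2) card by simp
  have "degree (\<Sum>j\<le>N. smult (poly p (lgl_node N j)) (lagrange N j)) \<le> N"
    by (intro degree_sum_le order_trans[OF degree_smult_le] degree_lagrange) auto
  thus "degree (\<Sum>j\<le>N. smult (poly p (lgl_node N j)) (lagrange N j)) < card (lgl_node N ` {..N})"
    using card by simp
  fix x assume "x \<in> lgl_node N ` {..N}"
  then obtain i where i: "i \<le> N" "x = lgl_node N i" by auto
  have "poly (\<Sum>j\<le>N. smult (poly p (lgl_node N j)) (lagrange N j)) x
      = (\<Sum>j\<le>N. poly p (lgl_node N j) * (if i = j then 1 else 0))"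
    using assms(1) i by (simp add: poly_sum poly_lagrange_node)
  also have "\<dots> = poly p x" using i by (simp add: sum.delta' if_distrib cong: if_cong)
  finally show "poly p x = poly (\<Sum>j\<le>N. smult (poly p (lgl_node N j)) (lagrange N j)) x" ..
qed

lemma poly_integrable [simp]: "poly p integrable_on {a..b :: real}"
  by (intro integrable_continuous_real continuous_intros)

lemma integral_poly_add:
  "integral {a..b :: real} (poly (p + q)) = integral {a..b} (poly p) + integral {a..b} (poly q)"
  using integral_add[of "poly p" "{a..b}" "poly q"] by (simp add: fun_eq_iff[THEN iffD2, OF allI, OF poly_add])

lemma integral_poly_smult:
  "integral {a..b :: real} (poly (smult c p)) = c * integral {a..b} (poly p)"
  using integral_mult_right[of "{a..b}" c "poly p"] by (simp add: fun_eq_iff[THEN iffD2, OF allI, OF poly_smult])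

lemma integral_poly_0 [simp]: "integral {a..b :: real} (poly 0) = 0"
  using integral_poly_smult[of a b 0 0] by simp

lemma integral_poly_sum:
  "integral {a..b :: real} (poly (\<Sum>i\<in>I. p i)) = (\<Sum>i\<in>I. integral {a..b} (poly (p i)))"
  by (induction I rule: infinite_finite_induct) (simp_all add: integral_poly_add del: poly_add)

lemma pderiv_sum: "pderiv (\<Sum>i\<in>I. p i) = (\<Sum>i\<in>I. pderiv (p i))"
  by (induction I rule: infinite_finite_induct) (simp_all add: pderiv_add)

lemma integral_pderiv:
  fixes p :: "real poly"
  assumes "a \<le> b"
  shows "integral {a..b} (poly (pderiv p)) = poly p b - poly p a"
  by (rule integral_unique, rule fundamental_theorem_of_calculus[OF assms])
    (use poly_DERIV[of p] in \<open>simp add: has_real_derivative_iff_has_vector_derivative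
       has_vector_derivative_at_within\<close>)

lemma integral_by_parts_poly:
  fixes p q :: "real poly"
  assumes "a \<le> b"
  shows "integral {a..b} (poly (p * pderiv q)) =
    poly (p * q) b - poly (p * q) a - integral {a..b} (poly (pderiv p * q))"
proof -
  have "integral {a..b} (poly (pderiv (p * q))) =
      integral {a..b} (poly (p * pderiv q)) + integral {a..b} (poly (pderiv p * q))"
    by (simp only: pderiv_mult integral_poly_add mult.commute)
  thus ?thesis using integral_pderiv[OF assms, of "p * q"] by simp
qed

text \<open>Orthogonality of the Legendre polynomials to polynomials of smaller degree, by repeated integration by
  parts; the intermediate derivatives in the formula of Rodrigues vanish at both end points. The case
  \<open>q = 0\<close> is listed separately because the zero polynomial has degree 0, which is not below \<open>k = 0\<close>
  at the end of the induction.\<close>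

lemma legendre_orthogonal:
  fixes q :: "real poly"
  assumes "k \<le> N" "q = 0 \<or> degree q < k"
  shows "integral {- 1..1} (poly (q * (pderiv ^^ k) ([:- 1, 0, 1:] ^ N))) = 0"
  using assms
proof (induction k arbitrary: q)
  case 0
  thus ?case by simp
next
  case (Suc k)
  have "integral {- 1..1} (poly (q * (pderiv ^^ Suc k) ([:- 1, 0, 1:] ^ N))) =
      - integral {- 1..1} (poly (pderiv q * (pderiv ^^ k) ([:- 1, 0, 1:] ^ N)))"
    using Suc.prems(1) rodrigues_endpoints[of k N 1] rodrigues_endpoints[of k N "- 1"]
      integral_by_parts_poly[of "- 1" 1 q "(pderiv ^^ k) ([:- 1, 0, 1:] ^ N)"]
    by simp
  moreover have "pderiv q = 0 \<or> degree (pderiv q) < k"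
    using Suc.prems(2) by (auto simp: degree_pderiv pderiv_eq_0_iff)
  ultimately show ?case using Suc.IH[of "pderiv q"] Suc.prems(1) by (simp del: poly_mult)
qed

text \<open>The factor \<open>1 - x\<^sup>2\<close> removes the boundary terms when the derivative is moved off the Legendre
  polynomial, which is then tested with a polynomial of degree below \<open>N\<close>.\<close>

lemma integral_lgl_poly_mult:
  assumes "N \<ge> 1" "q = 0 \<or> degree q < N - 1"
  shows "integral {- 1..1} (poly (q * lgl_poly N)) = 0"
proof (cases "q = 0")
  case False
  let ?e = "[:1, 0, - 1 :: real:]"
  have "degree (q * ?e) = degree q + 2"
    using False by (subst degree_mult_eq) auto
  hence "degree (pderiv (q * ?e)) < N"
    using assms False by (auto simp only: degree_pderiv)
  hence "integral {- 1..1} (poly (pderiv (q * ?e) * (pderiv ^^ N) ([:- 1, 0, 1:] ^ N))) = 0"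
    by (intro legendre_orthogonal) auto
  hence "integral {- 1..1} (poly (pderiv (q * ?e) * legendre N)) = 0"
    by (simp only: legendre_def mult_smult_right integral_poly_smult mult_zero_right)
  moreover have "integral {- 1..1} (poly (q * ?e * pderiv (legendre N))) =
      - integral {- 1..1} (poly (pderiv (q * ?e) * legendre N))"
    by (subst integral_by_parts_poly) auto
  ultimately show ?thesis by (simp only: lgl_poly_def mult.assoc)
qed simp

text \<open>Interpolatory quadrature integrates degree \<open>N\<close> exactly. The gain up to degree \<open>2 N - 1\<close> comes
  from division with remainder by the node polynomial: the multiple vanishes at the nodes and, by
  orthogonality, under the integral.\<close>

theorem lgl_quadrature_exact:
  assumes "N \<ge> 1" "degree p < 2 * N"
  shows "integral {- 1..1} (poly p) = (\<Sum>j\<le>N. lgl_weight N j * poly p (lgl_node N j))"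
proof -
  define q r where "q = p div lgl_poly N" and "r = p mod lgl_poly N"
  note P = degree_lgl_poly[OF assms(1)]
  have p: "p = q * lgl_poly N + r" by (simp add: q_def r_def)
  have r: "degree r \<le> N"
    using degree_mod_less[of "lgl_poly N" p] P by (auto simp: r_def)
  have q: "q = 0 \<or> degree q < N - 1"
  proof (cases "q = 0")
    case False
    have "degree q + Suc N = degree (q * lgl_poly N)"
      using False P by (simp add: degree_mult_eq)
    also have "\<dots> = degree (p - r)" using p by simp
    also have "\<dots> < 2 * N"
      using assms r degree_diff_le_max[of p r] by linarith
    finally show ?thesis by linarith
  qed simp
  have node: "poly (lgl_poly N) (lgl_node N j) = 0" if "j \<le> N" for j
    using that lgl_nodes(1)[OF assms(1)] by (auto simp: lgl_set_def)
  have "integral {- 1..1} (poly p) = integral {- 1..1} (poly r)"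
    using integral_lgl_poly_mult[OF assms(1) q] by (simp only: p integral_poly_add)
  also have "\<dots> = integral {- 1..1} (poly (\<Sum>j\<le>N. smult (poly r (lgl_node N j)) (lagrange N j)))"
    using lagrange_interpolation[OF assms(1) r] by simp
  also have "\<dots> = (\<Sum>j\<le>N. poly r (lgl_node N j) * lgl_weight N j)"
    by (simp only: integral_poly_sum integral_poly_smult lgl_weight_def)
  also have "\<dots> = (\<Sum>j\<le>N. lgl_weight N j * poly p (lgl_node N j))"
    by (intro sum.cong) (simp_all add: p node)
  finally show ?thesis .
qed

text \<open>The quadrature rule is exact for \<open>p = g\<^sup>2 e\<close>, which is nonnegative on the interval and vanishes at
  every node but the \<open>j\<close>-th, so that its integral is a positive multiple of the weight. The square of
  the \<open>j\<close>-th Lagrange polynomial cannot serve as \<open>p\<close>: its degree \<open>2 N\<close> is one too large. Squaring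
  only the factors \<open>g\<close> of the interior nodes and taking the end points with multiplicity one, in \<open>e\<close>,
  saves the missing degree.\<close>

lemma lgl_weight_nonneg:
  assumes "N \<ge> 1" "j \<le> N"
  shows "lgl_weight N j \<ge> 0"
proof -
  let ?x = "lgl_node N"
  define g where "g = (\<Prod>i\<in>{1..<N} - {j}. [:- ?x i, 1:])"
  define e where "e = (if j = 0 then [:1, - 1:] else if j = N then [:1, 1:] else [:1, 0, - 1 :: real:])"
  define p where "p = g ^ 2 * e"
  have "degree g \<le> (\<Sum>i\<in>{1..<N} - {j}. 1)"
    unfolding g_def using degree_prod_sum_le[of "{1..<N} - {j}" "\<lambda>i. [:- ?x i, 1:]"]
    by (simp add: comp_def)
  hence g: "degree g \<le> card ({1..<N} - {j})" by simp
  have "degree p \<le> degree g * 2 + degree e"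
    unfolding p_def by (intro order_trans[OF degree_mult_le] add_mono degree_power_le) simp
  also have "\<dots> < 2 * N"
  proof (cases "j = 0 \<or> j = N")
    case True
    hence "card ({1..<N} - {j}) = N - 1" "degree e = 1" by (auto simp: e_def)
    thus ?thesis using g assms(1) by linarith
  next
    case False
    hence "card ({1..<N} - {j}) = N - 2" "degree e = 2" "N \<ge> 2" using assms(2) by (auto simp: e_def)
    thus ?thesis using g by linarith
  qed
  finally have "integral {- 1..1} (poly p) = (\<Sum>i\<le>N. lgl_weight N i * poly p (?x i))"
    by (rule lgl_quadrature_exact[OF assms(1)])
  also have "\<dots> = (\<Sum>i\<le>N. if i = j then lgl_weight N i * poly p (?x i) else 0)"
  proof (intro sum.cong refl)
    fix i assume i: "i \<in> {..N}"
    have "poly p (?x i) = 0" if "i \<noteq> j"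
    proof (cases "i \<in> {1..<N}")
      case True
      hence "poly g (?x i) = 0" using that by (auto simp: g_def poly_prod)
      thus ?thesis by (simp add: p_def poly_power)
    next
      case False
      hence "i = 0 \<or> i = N" using i by auto
      hence "poly e (?x i) = 0"
        using that lgl_nodes(3,4)[OF assms(1)] by (auto simp: e_def)
      thus ?thesis by (simp add: p_def)
    qed
    thus "lgl_weight N i * poly p (?x i) = (if i = j then lgl_weight N i * poly p (?x i) else 0)"
      by auto
  qed
  also have "\<dots> = lgl_weight N j * poly p (?x j)" using assms(2) by simp
  finally have eq: "integral {- 1..1} (poly p) = lgl_weight N j * poly p (?x j)" .
  have e: "poly e x \<ge> 0" if "x \<in> {- 1..1}" for x
  proof -
    have "x * x \<le> 1" using that abs_square_le_1[of x] by (simp add: power2_eq_square abs_le_iff)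
    thus ?thesis using that by (auto simp: e_def)
  qed
  have "integral {- 1..1} (poly p) \<ge> 0"
    using e by (intro integral_nonneg) (auto simp: p_def poly_power)
  moreover have "poly p (?x j) > 0"
  proof -
    have "?x j \<noteq> ?x i" if "i \<le> N" "i \<noteq> j" for i using that assms lgl_node_eq_iff by auto
    hence "poly g (?x j) \<noteq> 0" by (auto simp: g_def poly_prod)
    moreover have "poly e (?x j) > 0"
    proof -
      have "?x j = - 1 \<longleftrightarrow> j = 0" "?x j = 1 \<longleftrightarrow> j = N"
        using lgl_node_eq_iff[OF assms(1), of j 0] lgl_node_eq_iff[OF assms(1), of j N]
          lgl_nodes(3,4)[OF assms(1)] assms(2) by auto
      hence "poly e (?x j) \<noteq> 0"
        using square_eq_1_iff[of "?x j"] assms(1) by (auto simp: e_def)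
      moreover have "poly e (?x j) \<ge> 0" using lgl_node_bounds[OF assms] by (intro e) simp
      ultimately show ?thesis by simp
    qed
    ultimately show ?thesis by (simp add: p_def poly_power)
  qed
  ultimately show ?thesis using eq by (metis zero_le_mult_iff not_le)
qed

text \<open>By uniqueness of interpolation, reflection at 0 turns the \<open>j\<close>-th Lagrange polynomial into the
  \<open>(N - j)\<close>-th.\<close>

lemma lgl_weight_reflect:
  assumes "N \<ge> 1" "j \<le> N"
  shows "lgl_weight N (N - j) = lgl_weight N j"
proof -
  have "pcompose (lagrange N j) [:0, - 1:] = lagrange N (N - j)" (is "?p = _")
  proof -
    have "degree ?p \<le> N" using degree_lagrange[OF assms(2)] by (simp add: degree_pcompose)
    hence "?p = (\<Sum>i\<le>N. smult (poly ?p (lgl_node N i)) (lagrange N i))"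
      by (rule lagrange_interpolation[OF assms(1)])
    also have "\<dots> = (\<Sum>i\<le>N. if i = N - j then lagrange N i else 0)"
    proof (intro sum.cong refl)
      fix i assume i: "i \<in> {..N}"
      have "poly ?p (lgl_node N i) = poly (lagrange N j) (lgl_node N (N - i))"
        using i assms by (simp add: poly_pcompose lgl_node_reflect)
      also have "\<dots> = (if N - i = j then 1 else 0)"
        using assms by (intro poly_lagrange_node) auto
      finally show "smult (poly ?p (lgl_node N i)) (lagrange N i)
          = (if i = N - j then lagrange N i else 0)"
        using i assms by auto
    qed
    also have "\<dots> = lagrange N (N - j)" by simp
    finally show ?thesis .
  qed
  hence "poly (lagrange N (N - j)) = (\<lambda>x. poly (lagrange N j) (- x))"
    by (simp add: fun_eq_iff poly_pcompose flip: \<open>?p = _\<close>)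
  hence "lgl_weight N (N - j) = integral {- 1..1} (\<lambda>x. poly (lagrange N j) (- x))"
    by (simp add: lgl_weight_def)
  also have "\<dots> = lgl_weight N j"
    unfolding lgl_weight_def using Henstock_Kurzweil_Integration.integral_reflect_real[of 1 "- 1" "poly (lagrange N j)"] by simp
  finally show ?thesis .
qed

text \<open>Quadrature is exact for the derivative of the product of two Lagrange polynomials, so the fundamental
  theorem of calculus survives discretization.\<close>

theorem lgl_summation_by_parts:
  assumes "N \<ge> 1" "i \<le> N" "j \<le> N"
  shows "lgl_weight N i * Dmat N i j + lgl_weight N j * Dmat N j i =
    (if i = N \<and> j = N then 1 else 0) - (if i = 0 \<and> j = 0 then 1 else 0)"
proof -
  let ?l = "lagrange N"
  have "degree (?l i * ?l j) \<le> 2 * N"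
    using degree_mult_le[of "?l i" "?l j"] degree_lagrange[of i N] degree_lagrange[of j N] assms
    by linarith
  hence "degree (pderiv (?l i * ?l j)) < 2 * N" using assms(1) by (simp add: degree_pderiv)
  hence "integral {- 1..1} (poly (pderiv (?l i * ?l j))) =
      (\<Sum>m\<le>N. lgl_weight N m * poly (pderiv (?l i * ?l j)) (lgl_node N m))"
    by (rule lgl_quadrature_exact[OF assms(1)])
  also have "\<dots> = (\<Sum>m\<le>N. (if m = i then lgl_weight N m * Dmat N m j else 0) +
      (if m = j then lgl_weight N m * Dmat N m i else 0))"
    using assms by (intro sum.cong) (auto simp: pderiv_mult poly_lagrange_node Dmat_def algebra_simps)
  also have "\<dots> = lgl_weight N i * Dmat N i j + lgl_weight N j * Dmat N j i"
    using assms by (simp add: sum.distrib)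
  finally have "lgl_weight N i * Dmat N i j + lgl_weight N j * Dmat N j i =
      poly (?l i * ?l j) 1 - poly (?l i * ?l j) (- 1)"
    by (simp add: integral_pderiv)
  thus ?thesis
    using poly_lagrange_node[of N N] poly_lagrange_node[of N 0] lgl_nodes(3,4)[OF assms(1)] assms
    by auto
qed

text \<open>The Lagrange polynomials form a partition of unity.\<close>

lemma Dmat_row_sum:
  assumes "N \<ge> 1"
  shows "(\<Sum>j\<le>N. Dmat N i j) = 0"
proof -
  have "(1 :: real poly) = (\<Sum>j\<le>N. lagrange N j)"
    using lagrange_interpolation[OF assms, of 1] by simp
  hence "pderiv (\<Sum>j\<le>N. lagrange N j) = 0" by (metis pderiv_1)
  hence "(\<Sum>j\<le>N. pderiv (lagrange N j)) = 0" by (simp add: pderiv_sum)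
  from arg_cong[OF this, of "\<lambda>p. poly p (lgl_node N i)"]
  show ?thesis by (simp add: Dmat_def poly_sum)
qed

section \<open>Summation by parts for two-point functions\<close>

text \<open>Here \<open>P i m\<close> stands for \<open>w(u\<^sub>i) \<bullet> G(u\<^sub>i, u\<^sub>m)\<close>, and the hypothesis says that \<open>P i m - \<psi> i\<close> is
  symmetric. So is its product \<open>c\<close> with \<open>a i + a m\<close>, and against a symmetric array the
  summation-by-parts matrix acts through its symmetric part, which consists of the two boundary entries.
  The rest, with \<open>\<psi> i\<close> in place of \<open>P i m\<close>, loses the part with \<open>a i\<close> to the vanishing row sums and
  keeps the discrete derivative of \<open>a\<close>.\<close>

lemma sum_by_parts_two_point:
  fixes P :: "nat \<Rightarrow> nat \<Rightarrow> real" and a \<psi> :: "nat \<Rightarrow> real"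
  assumes N: "N \<ge> 1"
    and P: "\<And>i m. i \<le> N \<Longrightarrow> m \<le> N \<Longrightarrow> P i m - P m i = \<psi> i - \<psi> m"
  shows "(\<Sum>i\<le>N. lgl_weight N i * (2 * (\<Sum>m\<le>N. Dmat N i m * ((a i + a m) / 2 * P i m)))) =
    (\<Sum>i\<le>N. lgl_weight N i * (\<psi> i * (\<Sum>m\<le>N. Dmat N i m * a m))) +
    (a N * (P N N - \<psi> N) - a 0 * (P 0 0 - \<psi> 0))"
proof -
  define Q where "Q i m = lgl_weight N i * Dmat N i m" for i m
  define c where "c i m = (a i + a m) * (P i m - \<psi> i)" for i m
  have "c i m = c m i" if "i \<le> N" "m \<le> N" for i m
  proof -
    have "P i m - \<psi> i = P m i - \<psi> m" using P[OF that] by simp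
    thus ?thesis by (simp add: c_def add.commute)
  qed
  hence "(\<Sum>i\<le>N. \<Sum>m\<le>N. Q m i * c i m) = (\<Sum>i\<le>N. \<Sum>m\<le>N. Q m i * c m i)"
    by (intro sum.cong) auto
  also have "\<dots> = (\<Sum>i\<le>N. \<Sum>m\<le>N. Q i m * c i m)" by (rule sum.swap)
  finally have "2 * (\<Sum>i\<le>N. \<Sum>m\<le>N. Q i m * c i m) = (\<Sum>i\<le>N. \<Sum>m\<le>N. (Q i m + Q m i) * c i m)"
    by (simp add: distrib_right sum.distrib)
  also have "\<dots> = (\<Sum>i\<le>N. \<Sum>m\<le>N.
      (if m = N then (if i = N then c i m else 0) else 0) - (if m = 0 then (if i = 0 then c i m else 0) else 0))"
    using lgl_summation_by_parts[OF N] by (intro sum.cong) (auto simp: Q_def)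
  also have "\<dots> = c N N - c 0 0" by (simp add: sum_subtractf)
  finally have sym: "(\<Sum>i\<le>N. \<Sum>m\<le>N. Q i m * c i m) = (c N N - c 0 0) / 2" by simp
  have "(\<Sum>i\<le>N. lgl_weight N i * (2 * (\<Sum>m\<le>N. Dmat N i m * ((a i + a m) / 2 * P i m)))) =
      (\<Sum>i\<le>N. \<Sum>m\<le>N. Q i m * c i m + lgl_weight N i * \<psi> i * a i * Dmat N i m
         + lgl_weight N i * \<psi> i * (Dmat N i m * a m))"
    by (simp add: sum_distrib_left Q_def c_def algebra_simps add_divide_distrib)
  also have "\<dots> = (\<Sum>i\<le>N. \<Sum>m\<le>N. Q i m * c i m) +
      (\<Sum>i\<le>N. lgl_weight N i * \<psi> i * a i * (\<Sum>m\<le>N. Dmat N i m)) +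
      (\<Sum>i\<le>N. lgl_weight N i * (\<psi> i * (\<Sum>m\<le>N. Dmat N i m * a m)))"
    by (simp only: sum.distrib sum_distrib_left mult.assoc)
  finally show ?thesis
    using sym Dmat_row_sum[OF N] by (simp add: c_def)
qed

section \<open>Coordinate lines and nodal derivatives on the reference cube\<close>

text \<open>The \<open>i\<close>-th node on the line in direction \<open>l\<close> whose two other indices are \<open>ab\<close>. The faces of the cube
  are the ends of these lines.\<close>

definition line_node :: "3 \<Rightarrow> nat \<times> nat \<Rightarrow> nat \<Rightarrow> idx" where
  "line_node l ab i =
     (if l = 1 then (i, fst ab, snd ab) else if l = 2 then (fst ab, i, snd ab) else (fst ab, snd ab, i))"

lemma face_node_line: "face_node N F ab = line_node (fst F) ab (if snd F then N else 0)"
  by (simp add: face_node_def line_node_def Let_def split: prod.split)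

lemma line_node_in_idxs: "a \<le> N \<Longrightarrow> b \<le> N \<Longrightarrow> i \<le> N \<Longrightarrow> line_node l (a, b) i \<in> idxs N"
  by (simp add: line_node_def idxs_def)

lemma weight3_line_node:
  "weight3 N (line_node l (a, b) i) = lgl_weight N a * lgl_weight N b * lgl_weight N i"
  by (simp add: line_node_def)

lemma sum_idxs: "(\<Sum>q\<in>idxs N. g q) = (\<Sum>i\<le>N. \<Sum>j\<le>N. \<Sum>k\<le>N. g (i, j, k))"
  by (simp add: idxs_def sum.cartesian_product)

lemma sum_idxs_line: "(\<Sum>q\<in>idxs N. g q) = (\<Sum>a\<le>N. \<Sum>b\<le>N. \<Sum>i\<le>N. g (line_node l (a, b) i))"
proof -
  have swap: "(\<Sum>j\<le>N. \<Sum>k\<le>N. h j k) = (\<Sum>k\<le>N. \<Sum>j\<le>N. h j k)" for h :: "nat \<Rightarrow> nat \<Rightarrow> 'a"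
    by (rule sum.swap)
  have 2: "(\<Sum>q\<in>idxs N. g q) = (\<Sum>a\<le>N. \<Sum>b\<le>N. \<Sum>i\<le>N. g (a, i, b))"
    unfolding sum_idxs by (intro sum.cong refl swap)
  have "(\<Sum>q\<in>idxs N. g q) = (\<Sum>a\<le>N. \<Sum>i\<le>N. \<Sum>b\<le>N. g (i, a, b))"
    unfolding sum_idxs by (rule swap)
  also have "\<dots> = (\<Sum>a\<le>N. \<Sum>b\<le>N. \<Sum>i\<le>N. g (i, a, b))"
    by (intro sum.cong refl swap)
  finally have 1: "(\<Sum>q\<in>idxs N. g q) = (\<Sum>a\<le>N. \<Sum>b\<le>N. \<Sum>i\<le>N. g (i, a, b))" .
  show ?thesis
    using 1 2 sum_idxs[of g N] by (cases "l = 1"; cases "l = 2") (simp_all add: line_node_def)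
qed

text \<open>The common form of the spatial derivative projection operators (with the two-point flux times the
  averaged metric coefficient for \<open>H\<close>) and of ordinary nodal differentiation (with \<open>H\<close> ignoring its
  first argument).\<close>

definition two_point_deriv :: "nat \<Rightarrow> 3 \<Rightarrow> (idx \<Rightarrow> idx \<Rightarrow> real) \<Rightarrow> idx \<Rightarrow> real" where
  "two_point_deriv N l H q = (case q of (i, j, k) \<Rightarrow>
     if l = 1 then \<Sum>m\<le>N. Dmat N i m * H q (m, j, k)
     else if l = 2 then \<Sum>m\<le>N. Dmat N j m * H q (i, m, k)
     else \<Sum>m\<le>N. Dmat N k m * H q (i, j, m))"

abbreviation nodal_deriv :: "nat \<Rightarrow> 3 \<Rightarrow> (idx \<Rightarrow> real) \<Rightarrow> idx \<Rightarrow> real" where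
  "nodal_deriv N l v \<equiv> two_point_deriv N l (\<lambda>_. v)"

lemma two_point_deriv_line_node:
  "two_point_deriv N l H (line_node l ab i) =
     (\<Sum>m\<le>N. Dmat N i m * H (line_node l ab i) (line_node l ab m))"
  by (simp add: two_point_deriv_def line_node_def)

lemma nodal_deriv_cong:
  assumes "\<And>p. p \<in> idxs N \<Longrightarrow> u p = v p" "q \<in> idxs N"
  shows "nodal_deriv N l u q = nodal_deriv N l v q"
  using assms by (auto simp: two_point_deriv_def idxs_def intro!: sum.cong)

lemma nodal_deriv_diff:
  "nodal_deriv N l (\<lambda>p. u p - v p) q = nodal_deriv N l u q - nodal_deriv N l v q"
  by (simp add: two_point_deriv_def sum_subtractf right_diff_distrib split: prod.split)

text \<open>Derivative matrices that act on different indices commute.\<close>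

lemma nodal_deriv_commute:
  "nodal_deriv N l (nodal_deriv N m v) q = nodal_deriv N m (nodal_deriv N l v) q"
proof -
  have swap: "(\<Sum>a\<le>N. c a * (\<Sum>b\<le>N. d b * h a b)) = (\<Sum>b\<le>N. d b * (\<Sum>a\<le>N. c a * h a b))"
    for c d :: "nat \<Rightarrow> real" and h
    by (simp add: sum_distrib_left mult.left_commute) (rule sum.swap)
  obtain i j k where q: "q = (i, j, k)" by (cases q)
  show ?thesis
    unfolding q two_point_deriv_def prod.case
    by (cases "l = 1"; cases "l = 2"; cases "m = 1"; cases "m = 2")
       (simp_all only: if_True if_False, (simp | rule swap)+)
qed

section \<open>Discrete metric identities\<close>

lemma has_derivative_interp3:
  "(interp3 N g has_derivative (\<lambda>h. \<Sum>(i, j, k)\<in>idxs N. g (node3 N (i, j, k)) *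
     (h $ 1 * poly (pderiv (lagrange N i)) (\<xi> $ 1) * poly (lagrange N j) (\<xi> $ 2) * poly (lagrange N k) (\<xi> $ 3) +
      h $ 2 * poly (lagrange N i) (\<xi> $ 1) * poly (pderiv (lagrange N j)) (\<xi> $ 2) * poly (lagrange N k) (\<xi> $ 3) +
      h $ 3 * poly (lagrange N i) (\<xi> $ 1) * poly (lagrange N j) (\<xi> $ 2) * poly (pderiv (lagrange N k)) (\<xi> $ 3))))
   (at \<xi> within S)"
proof -
  have nth: "((\<lambda>\<xi>. \<xi> $ l) has_derivative (\<lambda>h. h $ l)) (at \<xi> within S)" for l and \<xi> :: "real^3"
    by (rule bounded_linear_imp_has_derivative) (rule bounded_linear_vec_nth)
  have pol: "((\<lambda>\<xi>. poly p (\<xi> $ l)) has_derivative (\<lambda>h. h $ l * poly (pderiv p) (\<xi> $ l))) (at \<xi> within S)"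
    for p l and \<xi> :: "real^3"
    by (rule DERIV_compose_FDERIV[OF poly_DERIV nth])
  show ?thesis
    unfolding interp3_def[abs_def] split_beta
    by (rule derivative_eq_intros pol refl)+ (auto simp: algebra_simps split_beta intro!: sum.cong)
qed

text \<open>At the nodes the two Lagrange factors that are not differentiated reduce to Kronecker deltas, so the
  partial derivative of an interpolant is the derivative matrix acting along one coordinate line.\<close>

lemma pd_interp3:
  assumes N: "N \<ge> 1" and q: "q \<in> idxs N"
  shows "pd l (interp3 N g) (node3 N q) = nodal_deriv N l (\<lambda>p. g (node3 N p)) q"
proof -
  obtain i0 j0 k0 where q0: "q = (i0, j0, k0)" "i0 \<le> N" "j0 \<le> N" "k0 \<le> N"
    using q by (cases q) (auto simp: idxs_def)
  have "node3 N q \<in> cbox (vec (- 1)) (vec 1)"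
    using q0 lgl_node_bounds[OF N] by (simp add: mem_box_cart forall_3)
  hence "frechet_derivative (interp3 N g) (at (node3 N q) within E3) = (\<lambda>h. \<Sum>(i, j, k)\<in>idxs N. g (node3 N (i, j, k)) *
     (h $ 1 * poly (pderiv (lagrange N i)) (node3 N q $ 1) * poly (lagrange N j) (node3 N q $ 2) * poly (lagrange N k) (node3 N q $ 3) +
      h $ 2 * poly (lagrange N i) (node3 N q $ 1) * poly (pderiv (lagrange N j)) (node3 N q $ 2) * poly (lagrange N k) (node3 N q $ 3) +
      h $ 3 * poly (lagrange N i) (node3 N q $ 1) * poly (lagrange N j) (node3 N q $ 2) * poly (pderiv (lagrange N k)) (node3 N q $ 3)))"
    unfolding E3_def
    by (intro frechet_derivative_within_cbox has_derivative_interp3)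
       (auto simp: Basis_vec_def inner_axis)
  hence "pd l (interp3 N g) (node3 N q) = (\<Sum>i\<le>N. \<Sum>j\<le>N. \<Sum>k\<le>N. g (node3 N (i, j, k)) *
     ((if l = 1 then 1 else 0) * Dmat N i0 i * (if j = j0 then 1 else 0) * (if k = k0 then 1 else 0) +
      (if l = 2 then 1 else 0) * (if i = i0 then 1 else 0) * Dmat N j0 j * (if k = k0 then 1 else 0) +
      (if l = 3 then 1 else 0) * (if i = i0 then 1 else 0) * (if j = j0 then 1 else 0) * Dmat N k0 k))"
    unfolding pd_def sum_idxs
    using q0 N
    by (auto simp: axis_def Dmat_def poly_lagrange_node sum_idxs intro!: sum.cong)
  also have "\<dots> = nodal_deriv N l (\<lambda>p. g (node3 N p)) q"
  proof -
    have pull: "(\<Sum>j\<le>N. if c then h j else 0) = (if c then \<Sum>j\<le>N. h j else 0)"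
      for c and h :: "nat \<Rightarrow> real" by simp
    show ?thesis
      using exhaust_3[of l] q0
      by (auto simp: two_point_deriv_def mult_delta_left mult_delta_right pull mult.commute)
  qed
  finally show ?thesis .
qed

lemma Ja_nodal:
  assumes "N \<ge> 1" "q \<in> idxs N"
  shows "Ja N X l a q =
    nodal_deriv N (l + 2) (\<lambda>p. X (node3 N p) $ (a + 2) * pd (l + 1) (\<lambda>\<zeta>. X \<zeta> $ (a + 1)) (node3 N p)) q -
    nodal_deriv N (l + 1) (\<lambda>p. X (node3 N p) $ (a + 2) * pd (l + 2) (\<lambda>\<zeta>. X \<zeta> $ (a + 1)) (node3 N p)) q"
  unfolding Ja_def curl_def by (simp add: pd_interp3[OF assms])

text \<open>The divergence of a curl vanishes, here as an identity between nodal values: at the nodes the curl is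
  formed with derivative matrices, and these commute exactly as partial derivatives do.\<close>

theorem discrete_metric_identities:
  assumes N: "N \<ge> 1" and q: "q \<in> idxs N"
  shows "(\<Sum>l\<in>UNIV. nodal_deriv N l (Ja N X l a) q) = 0"
proof -
  define v where "v b p = X (node3 N p) $ (a + 2) * pd b (\<lambda>\<zeta>. X \<zeta> $ (a + 1)) (node3 N p)" for b p
  have "nodal_deriv N l (Ja N X l a) q =
      nodal_deriv N l (nodal_deriv N (l + 2) (v (l + 1))) q - nodal_deriv N l (nodal_deriv N (l + 1) (v (l + 2))) q" for l
    unfolding nodal_deriv_diff[symmetric]
    by (rule nodal_deriv_cong[OF _ q]) (simp add: Ja_nodal[OF N] v_def[abs_def])
  \<comment> \<open>Directions are cyclic, so the six second derivatives form three pairs of opposite sign.\<close>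
  moreover have "(1::3) + 1 = 2" "(1::3) + 2 = 3" "(2::3) + 1 = 3" "(2::3) + 2 = 1"
    "(3::3) + 1 = 1" "(3::3) + 2 = 2" by simp_all
  ultimately show ?thesis
    by (simp only: sum_3) (simp add: nodal_deriv_commute[of N 2 1] nodal_deriv_commute[of N 3 1]
        nodal_deriv_commute[of N 3 2])
qed

section \<open>Entropy balance of the spatial volume terms\<close>

text \<open>Summation by parts on every coordinate line in direction \<open>l\<close>; the boundary terms sit on the two
  faces orthogonal to that direction.\<close>

lemma two_point_deriv_by_parts:
  fixes P :: "idx \<Rightarrow> idx \<Rightarrow> real" and a \<psi> :: "idx \<Rightarrow> real"
  assumes N: "N \<ge> 1"
    and P: "\<And>p p'. p \<in> idxs N \<Longrightarrow> p' \<in> idxs N \<Longrightarrow> P p p' - P p' p = \<psi> p - \<psi> p'"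
  shows "(\<Sum>q\<in>idxs N. weight3 N q * (2 * two_point_deriv N l (\<lambda>p p'. (a p + a p') / 2 * P p p') q)) =
    (\<Sum>q\<in>idxs N. weight3 N q * (\<psi> q * nodal_deriv N l a q)) +
    (\<Sum>b\<le>N. \<Sum>c\<le>N. lgl_weight N b * lgl_weight N c *
       (a (line_node l (b, c) N) * (P (line_node l (b, c) N) (line_node l (b, c) N) - \<psi> (line_node l (b, c) N)) -
        a (line_node l (b, c) 0) * (P (line_node l (b, c) 0) (line_node l (b, c) 0) - \<psi> (line_node l (b, c) 0))))"
proof -
  have "(\<Sum>i\<le>N. weight3 N (line_node l (b, c) i) *
        (2 * two_point_deriv N l (\<lambda>p p'. (a p + a p') / 2 * P p p') (line_node l (b, c) i))) =
      (\<Sum>i\<le>N. weight3 N (line_node l (b, c) i) *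
        (\<psi> (line_node l (b, c) i) * nodal_deriv N l a (line_node l (b, c) i))) +
      lgl_weight N b * lgl_weight N c *
       (a (line_node l (b, c) N) * (P (line_node l (b, c) N) (line_node l (b, c) N) - \<psi> (line_node l (b, c) N)) -
        a (line_node l (b, c) 0) * (P (line_node l (b, c) 0) (line_node l (b, c) 0) - \<psi> (line_node l (b, c) 0)))"
    if bc: "b \<le> N" "c \<le> N" for b c
  proof -
    let ?n = "line_node l (b, c)"
    have "(\<Sum>i\<le>N. lgl_weight N i * (2 * (\<Sum>m\<le>N. Dmat N i m * ((a (?n i) + a (?n m)) / 2 * P (?n i) (?n m))))) =
      (\<Sum>i\<le>N. lgl_weight N i * (\<psi> (?n i) * (\<Sum>m\<le>N. Dmat N i m * a (?n m)))) +
      (a (?n N) * (P (?n N) (?n N) - \<psi> (?n N)) - a (?n 0) * (P (?n 0) (?n 0) - \<psi> (?n 0)))"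
      by (rule sum_by_parts_two_point[OF N]) (intro P line_node_in_idxs bc; assumption)
    from arg_cong[OF this, of "\<lambda>x. lgl_weight N b * lgl_weight N c * x"]
    show ?thesis
      by (simp only: weight3_line_node two_point_deriv_line_node distrib_left sum_distrib_left mult.assoc)
  qed
  thus ?thesis
    unfolding sum_idxs_line[of _ N l] by (simp add: sum.distrib)
qed

text \<open>The length of the scaled normal cancels. Where the scaled normal vanishes both sides are 0, since the
  unit normal is then 0 by the convention for division.\<close>

lemma normal_flux_eq:
  "normal_flux N X F q h = (\<Sum>m\<in>UNIV. (scaled_normal N X F q $ m) *\<^sub>R h m)"
  by (cases "scaled_normal N X F q = 0")
     (simp_all add: normal_flux_def unit_normal_def shat_def scaleR_sum_right flip: mult.assoc)

lemma scaled_normal_nth: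
  "scaled_normal N X F q $ r = (if snd F then 1 else - 1) * Ja N X (fst F) r q"
  by (simp add: scaled_normal_def nhat_def axis_def if_distrib[of "\<lambda>x. x * _"] cong: if_cong)

lemma sum_faces: "(\<Sum>F\<in>UNIV. g (F :: face)) = (\<Sum>l\<in>UNIV. g (l, True) + g (l, False))"
proof -
  have "(\<Sum>F\<in>UNIV. g (F :: face)) = (\<Sum>l\<in>UNIV. \<Sum>b\<in>UNIV. g (l, b))"
    by (simp add: sum.cartesian_product flip: UNIV_Times_UNIV)
  thus ?thesis by (simp add: UNIV_bool add.commute)
qed

lemma two_point_consistent:
  "two_point A w g \<psi> G \<Longrightarrow> a \<in> A \<Longrightarrow> G a a = g a"
  by (simp add: two_point_def)

text \<open>By symmetry of \<open>G\<close> this is the entropy condition, written so that \<open>w a \<bullet> G a b - \<psi> a\<close> is visibly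
  symmetric.\<close>

lemma two_point_jump:
  "two_point A w g \<psi> G \<Longrightarrow> a \<in> A \<Longrightarrow> b \<in> A \<Longrightarrow> w a \<bullet> G a b - w b \<bullet> G b a = \<psi> a - \<psi> b"
  by (auto simp: two_point_def simp flip: inner_diff_left)

lemma inner_DN:
  "DN N X FEC U \<sigma> q \<bullet> W q = (\<Sum>l\<in>UNIV. \<Sum>r\<in>UNIV. 2 * two_point_deriv N l
     (\<lambda>p p'. (Ja N X l r p + Ja N X l r p') / 2 * (W p \<bullet> FEC r (U \<sigma> p) (U \<sigma> p'))) q)"
proof -
  obtain i j k where q: "q = (i, j, k)" by (cases q)
  have swap: "(\<Sum>m\<le>N. \<Sum>r\<in>UNIV. h m r) = (\<Sum>r\<in>UNIV. \<Sum>m\<le>N. h m r)"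
    for h :: "nat \<Rightarrow> 3 \<Rightarrow> real" by (rule sum.swap)
  have "DN N X FEC U \<sigma> q \<bullet> W q = 2 * (\<Sum>r\<in>UNIV. \<Sum>l\<in>UNIV. two_point_deriv N l
     (\<lambda>p p'. (Ja N X l r p + Ja N X l r p') / 2 * (W p \<bullet> FEC r (U \<sigma> p) (U \<sigma> p'))) q)"
    unfolding q
    by (simp add: inner_sum_left inner_add_left swap sum_3 two_point_deriv_def sum.distrib
        inner_commute[of "W _"] mult.assoc)
  also have "\<dots> = 2 * (\<Sum>l\<in>UNIV. \<Sum>r\<in>UNIV. two_point_deriv N l
     (\<lambda>p p'. (Ja N X l r p + Ja N X l r p') / 2 * (W p \<bullet> FEC r (U \<sigma> p) (U \<sigma> p'))) q)"
    by (subst sum.swap) (rule refl)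
  finally show ?thesis by (simp only: sum_distrib_left)
qed

text \<open>The volume terms of an element act only through its boundary: after summation by parts in every
  direction, what multiplies the potential \<open>\<psi> r\<close> at a node is the discrete divergence of the
  \<open>r\<close>-th components of the contravariant vectors.\<close>

theorem volume_entropy_balance:
  assumes N: "N \<ge> 1"
    and EC: "\<And>r. two_point A w (f r) (\<psi> r) (FEC r)"
    and U: "\<And>q. q \<in> idxs N \<Longrightarrow> U \<sigma> q \<in> A"
  shows "inner_N N (DN N X FEC U \<sigma>) (\<lambda>q. w (U \<sigma> q)) =
    (\<Sum>F\<in>UNIV. \<Sum>a\<le>N. \<Sum>b\<le>N. lgl_weight N a * lgl_weight N b *
       (\<Sum>r\<in>UNIV. scaled_normal N X F (face_node N F (a, b)) $ r *
          (w (U \<sigma> (face_node N F (a, b))) \<bullet> f r (U \<sigma> (face_node N F (a, b))) -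
           \<psi> r (U \<sigma> (face_node N F (a, b))))))"
proof -
  define e where "e r q = w (U \<sigma> q) \<bullet> f r (U \<sigma> q) - \<psi> r (U \<sigma> q)" for r q
  define B where "B l r = (\<Sum>b\<le>N. \<Sum>c\<le>N. lgl_weight N b * lgl_weight N c *
     (Ja N X l r (line_node l (b, c) N) * e r (line_node l (b, c) N) -
      Ja N X l r (line_node l (b, c) 0) * e r (line_node l (b, c) 0)))" for l r
  have parts: "(\<Sum>q\<in>idxs N. weight3 N q * (2 * two_point_deriv N l
        (\<lambda>p p'. (Ja N X l r p + Ja N X l r p') / 2 * (w (U \<sigma> p) \<bullet> FEC r (U \<sigma> p) (U \<sigma> p'))) q)) =
      (\<Sum>q\<in>idxs N. weight3 N q * (\<psi> r (U \<sigma> q) * nodal_deriv N l (Ja N X l r) q)) + B l r" for l r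
  proof -
    note two_point_deriv_by_parts[OF N, of "\<lambda>p p'. w (U \<sigma> p) \<bullet> FEC r (U \<sigma> p) (U \<sigma> p')"
        "\<lambda>p. \<psi> r (U \<sigma> p)" l "Ja N X l r"]
    moreover have "w (U \<sigma> p) \<bullet> FEC r (U \<sigma> p) (U \<sigma> p') - w (U \<sigma> p') \<bullet> FEC r (U \<sigma> p') (U \<sigma> p) =
        \<psi> r (U \<sigma> p) - \<psi> r (U \<sigma> p')" if "p \<in> idxs N" "p' \<in> idxs N" for p p'
      using two_point_jump[OF EC U U] that by blast
    moreover have "FEC r (U \<sigma> (line_node l (b, c) i)) (U \<sigma> (line_node l (b, c) i)) =
        f r (U \<sigma> (line_node l (b, c) i))" if "b \<le> N" "c \<le> N" "i \<le> N" for b c i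
      by (intro two_point_consistent[OF EC] U line_node_in_idxs that)
    ultimately show ?thesis by (simp add: B_def e_def)
  qed
  have "inner_N N (DN N X FEC U \<sigma>) (\<lambda>q. w (U \<sigma> q)) =
      (\<Sum>q\<in>idxs N. \<Sum>l\<in>UNIV. \<Sum>r\<in>UNIV. weight3 N q * (2 * two_point_deriv N l
        (\<lambda>p p'. (Ja N X l r p + Ja N X l r p') / 2 * (w (U \<sigma> p) \<bullet> FEC r (U \<sigma> p) (U \<sigma> p'))) q))"
    unfolding inner_N_def inner_DN[where W = "\<lambda>q. w (U \<sigma> q)"] sum_distrib_left by (rule refl)
  also have "\<dots> = (\<Sum>l\<in>UNIV. \<Sum>r\<in>UNIV. \<Sum>q\<in>idxs N. weight3 N q * (2 * two_point_deriv N l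
        (\<lambda>p p'. (Ja N X l r p + Ja N X l r p') / 2 * (w (U \<sigma> p) \<bullet> FEC r (U \<sigma> p) (U \<sigma> p'))) q))"
    by (subst sum.swap, intro sum.cong refl, rule sum.swap)
  also have "\<dots> = (\<Sum>l\<in>UNIV. \<Sum>r\<in>UNIV. \<Sum>q\<in>idxs N. weight3 N q * (\<psi> r (U \<sigma> q) * nodal_deriv N l (Ja N X l r) q)) +
      (\<Sum>l\<in>UNIV. \<Sum>r\<in>UNIV. B l r)"
    by (simp only: parts sum.distrib)
  also have "(\<Sum>l\<in>UNIV. \<Sum>r\<in>UNIV. \<Sum>q\<in>idxs N. weight3 N q * (\<psi> r (U \<sigma> q) * nodal_deriv N l (Ja N X l r) q)) =
      (\<Sum>r\<in>UNIV. \<Sum>q\<in>idxs N. \<Sum>l\<in>UNIV. weight3 N q * (\<psi> r (U \<sigma> q) * nodal_deriv N l (Ja N X l r) q))"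
    by (subst sum.swap, intro sum.cong refl, rule sum.swap)
  also have "\<dots> = 0"
    by (simp only: sum_distrib_left[symmetric])
       (simp add: discrete_metric_identities[OF N])
  also have "0 + (\<Sum>l\<in>UNIV. \<Sum>r\<in>UNIV. B l r) = (\<Sum>F\<in>UNIV. \<Sum>a\<le>N. \<Sum>b\<le>N. lgl_weight N a * lgl_weight N b *
       (\<Sum>r\<in>UNIV. scaled_normal N X F (face_node N F (a, b)) $ r * e r (face_node N F (a, b))))"
  proof -
    have "(\<Sum>r\<in>UNIV. B l r) =
       (\<Sum>a\<le>N. \<Sum>b\<le>N. lgl_weight N a * lgl_weight N b *
         (\<Sum>r\<in>UNIV. scaled_normal N X (l, True) (face_node N (l, True) (a, b)) $ r * e r (face_node N (l, True) (a, b)))) +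
       (\<Sum>a\<le>N. \<Sum>b\<le>N. lgl_weight N a * lgl_weight N b *
         (\<Sum>r\<in>UNIV. scaled_normal N X (l, False) (face_node N (l, False) (a, b)) $ r * e r (face_node N (l, False) (a, b))))" for l
      by (simp add: B_def scaled_normal_nth face_node_line sum_3 algebra_simps sum.distrib
          sum_subtractf sum_negf)
    thus ?thesis by (simp only: sum_faces)
  qed
  finally show ?thesis by (simp add: e_def)
qed

section \<open>Entropy balance in time\<close>

text \<open>The case of the coefficient 1, whose derivative vanishes. At equal states the boundary terms
  \<open>w \<bullet> u - \<Phi>\<close> are the entropy itself.\<close>

lemma temporal_entropy_balance:
  fixes V :: "nat \<Rightarrow> real^'p"
  assumes M: "M \<ge> 1"
    and Us: "two_point A w (\<lambda>u. u) (Phi s w) Us"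
    and V: "\<And>\<sigma>. \<sigma> \<le> M \<Longrightarrow> V \<sigma> \<in> A"
  shows "(\<Sum>\<sigma>\<le>M. lgl_weight M \<sigma> * ((2 *\<^sub>R (\<Sum>\<theta>\<le>M. Dmat M \<sigma> \<theta> *\<^sub>R Us (V \<sigma>) (V \<theta>))) \<bullet> w (V \<sigma>))) =
    s (V M) - s (V 0)"
proof -
  have "(\<Sum>\<sigma>\<le>M. lgl_weight M \<sigma> * (2 * (\<Sum>\<theta>\<le>M. Dmat M \<sigma> \<theta> * ((1 + 1) / 2 * (w (V \<sigma>) \<bullet> Us (V \<sigma>) (V \<theta>)))))) =
    (\<Sum>\<sigma>\<le>M. lgl_weight M \<sigma> * (Phi s w (V \<sigma>) * (\<Sum>\<theta>\<le>M. Dmat M \<sigma> \<theta> * 1))) +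
    (1 * (w (V M) \<bullet> Us (V M) (V M) - Phi s w (V M)) - 1 * (w (V 0) \<bullet> Us (V 0) (V 0) - Phi s w (V 0)))"
    by (rule sum_by_parts_two_point[OF M, where a = "\<lambda>_. 1"]) (intro two_point_jump[OF Us] V; assumption)
  thus ?thesis
    using two_point_consistent[OF Us V] Dmat_row_sum[OF M]
    by (simp add: inner_sum_left inner_commute[of "w _"] Phi_def)
qed

text \<open>The upwind state at the end of the interval equals the solution there and leaves no correction. At the
  start, \<open>s + w \<bullet> (UL - u)\<close> is rewritten as \<open>w \<bullet> UL - \<Phi>\<close>, the form in which the jump condition applies.\<close>

lemma A_T_entropy:
  assumes M: "M \<ge> 1" and Us: "two_point A w (\<lambda>u. u) (Phi s w) Us"
    and U: "\<And>\<sigma> q. \<sigma> \<le> M \<Longrightarrow> q \<in> idxs N \<Longrightarrow> U \<sigma> q \<in> A"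
    and UR: "\<And>q. q \<in> idxs N \<Longrightarrow> UR q = U M q"
  shows "A_T N M J Us UL UR U (\<lambda>\<sigma> q. w (U \<sigma> q)) =
    (\<Sum>q\<in>idxs N. weight3 N q * J q * (s (U M q) - (w (U 0 q) \<bullet> UL q - Phi s w (U 0 q))))"
proof -
  have "inner_NM N M (\<lambda>\<sigma> q. J q *\<^sub>R DM M Us U \<sigma> q) (\<lambda>\<sigma> q. w (U \<sigma> q)) =
      (\<Sum>q\<in>idxs N. \<Sum>\<sigma>\<le>M. weight3 N q * J q * (lgl_weight M \<sigma> * (DM M Us U \<sigma> q \<bullet> w (U \<sigma> q))))"
    unfolding inner_NM_def inner_N_def sum_distrib_left
    by (subst sum.swap) (simp add: ac_simps)
  also have "\<dots> = (\<Sum>q\<in>idxs N. weight3 N q * J q * (s (U M q) - s (U 0 q)))"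
    unfolding sum_distrib_left[symmetric] DM_def
    by (intro sum.cong refl arg_cong2[where f = "(*)"] temporal_entropy_balance[OF M Us] U)
  finally show ?thesis
    using UR
    by (simp add: A_T_def inner_N_def Phi_def inner_diff_left inner_commute[of "w _"]
        algebra_simps sum.distrib sum_subtractf)
qed

section \<open>Cancellation at the interfaces of a periodic mesh\<close>

lemma sym_act_le: "a \<le> N \<Longrightarrow> b \<le> N \<Longrightarrow> fst (sym_act N g (a, b)) \<le> N \<and> snd (sym_act N g (a, b)) \<le> N"
  by (cases g rule: prod_cases3) (auto simp: Let_def)

text \<open>The two elements at an interface weight a common face node equally, however they number the face
  nodes.\<close>

lemma lgl_weight_sym_act:
  assumes "N \<ge> 1" "a \<le> N" "b \<le> N"
  shows "lgl_weight N (fst (sym_act N g (a, b))) * lgl_weight N (snd (sym_act N g (a, b))) =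
    lgl_weight N a * lgl_weight N b"
  using assms lgl_weight_reflect[OF assms(1)]
  by (cases g rule: prod_cases3) (auto simp: Let_def)

text \<open>Passing to the other side of the interface is an involution \<open>\<iota>\<close> on the set \<open>S\<close> of pairs of a side and
  a face node. It preserves the weights, reverses the scaled normals and exchanges the two states, while
  \<open>w a \<bullet> F a b - \<psi> a\<close> is symmetric in the states; so it changes the sign of every summand.\<close>

lemma interface_sum_zero:
  assumes N: "N \<ge> 1"
    and mesh: "periodic_mesh N \<Omega> KS X nb orient shift"
    and EC: "\<And>r. two_point A w (f r) (\<psi> r) (FEC r)"
    and V: "\<And>k q. k \<in> {1..KS} \<Longrightarrow> q \<in> idxs N \<Longrightarrow> V k q \<in> A"
  shows "(\<Sum>k=1..KS. \<Sum>F\<in>UNIV. \<Sum>a\<le>N. \<Sum>b\<le>N. lgl_weight N a * lgl_weight N b *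
     (\<Sum>r\<in>UNIV. scaled_normal N (X k) F (face_node N F (a, b)) $ r *
        (w (V k (face_node N F (a, b))) \<bullet> FEC r (V k (face_node N F (a, b)))
            (V (fst (nb (k, F))) (face_node N (snd (nb (k, F))) (sym_act N (orient (k, F)) (a, b)))) -
         \<psi> r (V k (face_node N F (a, b)))))) = 0"
proof -
  define S where "S = ({1..KS} \<times> (UNIV :: face set)) \<times> ({..N} \<times> {..N})"
  define st where "st = (\<lambda>(K, ab). V (fst K) (face_node N (snd K) ab))"
  define nrm where "nrm = (\<lambda>(K, ab). scaled_normal N (X (fst K)) (snd K) (face_node N (snd K) ab))"
  define \<iota> where "\<iota> = (\<lambda>(K, ab). (nb K, sym_act N (orient K) ab))"
  define wt where "wt x = lgl_weight N (fst (snd x)) * lgl_weight N (snd (snd x))"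
    for x :: "(nat \<times> face) \<times> nat \<times> nat"
  define h where "h x = wt x * (\<Sum>r\<in>UNIV. nrm x $ r *
      (w (st x) \<bullet> FEC r (st x) (st (\<iota> x)) - \<psi> r (st x)))" for x
  have mesh': "nb K \<in> {1..KS} \<times> UNIV" "nb (nb K) = K"
      "a \<le> N \<Longrightarrow> b \<le> N \<Longrightarrow> sym_act N (orient (nb K)) (sym_act N (orient K) (a, b)) = (a, b)"
      "matched_sides N \<Omega> X (orient K) (shift K) K (nb K)"
    if "K \<in> {1..KS} \<times> UNIV" for K a b
    using mesh that unfolding periodic_mesh_def by blast+
  have iS: "\<iota> x \<in> S" and ii: "\<iota> (\<iota> x) = x" and iw: "wt (\<iota> x) = wt x"
    and inrm: "nrm (\<iota> x) = - nrm x" and stA: "st x \<in> A" if "x \<in> S" for x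
  proof -
    obtain K a b where x: "x = (K, (a, b))" by (cases x) auto
    have K: "K \<in> {1..KS} \<times> UNIV" and ab: "a \<le> N" "b \<le> N"
      using that by (auto simp: x S_def)
    show "\<iota> x \<in> S"
      using mesh'(1)[OF K] sym_act_le[OF ab, of "orient K"]
      by (auto simp: x S_def \<iota>_def mem_Times_iff)
    show "\<iota> (\<iota> x) = x" using mesh'(2,3)[OF K] ab by (simp add: x \<iota>_def)
    show "wt (\<iota> x) = wt x" using lgl_weight_sym_act[OF N ab] by (simp add: x wt_def \<iota>_def)
    show "nrm (\<iota> x) = - nrm x"
      using mesh'(4)[OF K] ab by (simp add: x nrm_def \<iota>_def matched_sides_def Let_def)
    show "st x \<in> A"
      using K ab by (auto simp: x st_def face_node_line intro!: V line_node_in_idxs)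
  qed
  have anti: "h (\<iota> x) = - h x" if x: "x \<in> S" for x
  proof -
    have "w (st (\<iota> x)) \<bullet> FEC r (st (\<iota> x)) (st x) - \<psi> r (st (\<iota> x)) =
        w (st x) \<bullet> FEC r (st x) (st (\<iota> x)) - \<psi> r (st x)" for r
      using two_point_jump[OF EC stA[OF x] stA[OF iS[OF x]], of r] by simp
    thus ?thesis
      by (simp add: h_def ii[OF x] iw[OF x] inrm[OF x] sum_negf)
  qed
  have "(\<Sum>x\<in>S. h x) = (\<Sum>x\<in>S. h (\<iota> x))"
    by (rule sum.reindex_bij_witness[of _ \<iota> \<iota>]) (auto simp: iS ii)
  also have "\<dots> = - (\<Sum>x\<in>S. h x)"
    by (simp add: anti sum_negf)
  finally have "(\<Sum>x\<in>S. h x) = 0" by simp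
  moreover have "(\<Sum>x\<in>S. h x) = (\<Sum>k=1..KS. \<Sum>F\<in>UNIV. \<Sum>a\<le>N. \<Sum>b\<le>N. h ((k, F), (a, b)))"
    by (simp add: S_def sum.cartesian_product')
  ultimately show ?thesis
    by (simp add: h_def wt_def nrm_def st_def \<iota>_def)
qed

section \<open>Entropy balance in space and entropy stability\<close>

text \<open>In the surface term the physical flux of the inner state cancels against the one that the volume term
  leaves on the faces. The numerical flux stays, tested with the entropy variables and reduced by the
  potential.\<close>

lemma A_S_entropy:
  assumes N: "N \<ge> 1"
    and EC: "\<And>r. two_point A w (f r) (\<psi> r) (FEC r)"
    and U: "\<And>\<sigma> q. \<sigma> \<le> M \<Longrightarrow> q \<in> idxs N \<Longrightarrow> U \<sigma> q \<in> A"
    and Fstar: "\<And>F \<sigma> a b. \<sigma> \<le> M \<Longrightarrow> a \<le> N \<Longrightarrow> b \<le> N \<Longrightarrow>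
      Fstar F \<sigma> (a, b) = normal_flux N X F (face_node N F (a, b))
        (\<lambda>r. FEC r (U \<sigma> (face_node N F (a, b))) (Uout F \<sigma> (a, b)))"
  shows "A_S N M X dt f FEC Fstar U (\<lambda>\<sigma> q. w (U \<sigma> q)) =
    dt / 2 * (\<Sum>\<sigma>\<le>M. lgl_weight M \<sigma> * (\<Sum>F\<in>UNIV. \<Sum>a\<le>N. \<Sum>b\<le>N. lgl_weight N a * lgl_weight N b *
      (\<Sum>r\<in>UNIV. scaled_normal N X F (face_node N F (a, b)) $ r *
        (w (U \<sigma> (face_node N F (a, b))) \<bullet> FEC r (U \<sigma> (face_node N F (a, b))) (Uout F \<sigma> (a, b)) -
         \<psi> r (U \<sigma> (face_node N F (a, b)))))))"
proof -
  define n where "n F a b r = scaled_normal N X F (face_node N F (a, b)) $ r" for F a b r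
  define u where "u F \<sigma> a b = U \<sigma> (face_node N F (a, b))" for F \<sigma> a b
  have "face_integral N M (\<lambda>F \<sigma> ab. let q = face_node N F ab in
         w (U \<sigma> q) \<bullet> (Fstar F \<sigma> ab - normal_flux N X F q (\<lambda>m. f m (U \<sigma> q)))) =
      (\<Sum>F\<in>UNIV. \<Sum>a\<le>N. \<Sum>b\<le>N. \<Sum>\<sigma>\<le>M. lgl_weight M \<sigma> * (lgl_weight N a * lgl_weight N b *
         (\<Sum>r\<in>UNIV. n F a b r *
           (w (u F \<sigma> a b) \<bullet> FEC r (u F \<sigma> a b) (Uout F \<sigma> (a, b)) - w (u F \<sigma> a b) \<bullet> f r (u F \<sigma> a b)))))"
    unfolding face_integral_def Let_def
    by (intro sum.cong refl)
       (simp add: Fstar normal_flux_eq n_def u_def inner_diff_right inner_sum_right right_diff_distrib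
         sum_subtractf ac_simps)
  also have "\<dots> = (\<Sum>F\<in>UNIV. \<Sum>a\<le>N. \<Sum>\<sigma>\<le>M. \<Sum>b\<le>N. lgl_weight M \<sigma> * (lgl_weight N a * lgl_weight N b *
         (\<Sum>r\<in>UNIV. n F a b r *
           (w (u F \<sigma> a b) \<bullet> FEC r (u F \<sigma> a b) (Uout F \<sigma> (a, b)) - w (u F \<sigma> a b) \<bullet> f r (u F \<sigma> a b)))))"
    by (rule sum.cong[OF refl], rule sum.cong[OF refl], rule sum.swap)
  also have "\<dots> = (\<Sum>F\<in>UNIV. \<Sum>\<sigma>\<le>M. \<Sum>a\<le>N. \<Sum>b\<le>N. lgl_weight M \<sigma> * (lgl_weight N a * lgl_weight N b *
         (\<Sum>r\<in>UNIV. n F a b r *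
           (w (u F \<sigma> a b) \<bullet> FEC r (u F \<sigma> a b) (Uout F \<sigma> (a, b)) - w (u F \<sigma> a b) \<bullet> f r (u F \<sigma> a b)))))"
    by (rule sum.cong[OF refl], rule sum.swap)
  also have "\<dots> = (\<Sum>\<sigma>\<le>M. \<Sum>F\<in>UNIV. \<Sum>a\<le>N. \<Sum>b\<le>N. lgl_weight M \<sigma> * (lgl_weight N a * lgl_weight N b *
         (\<Sum>r\<in>UNIV. n F a b r *
           (w (u F \<sigma> a b) \<bullet> FEC r (u F \<sigma> a b) (Uout F \<sigma> (a, b)) - w (u F \<sigma> a b) \<bullet> f r (u F \<sigma> a b)))))"
    by (rule sum.swap)
  finally have surface: "face_integral N M (\<lambda>F \<sigma> ab. let q = face_node N F ab in
         w (U \<sigma> q) \<bullet> (Fstar F \<sigma> ab - normal_flux N X F q (\<lambda>m. f m (U \<sigma> q)))) =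
      (\<Sum>\<sigma>\<le>M. lgl_weight M \<sigma> * (\<Sum>F\<in>UNIV. \<Sum>a\<le>N. \<Sum>b\<le>N. lgl_weight N a * lgl_weight N b *
         (\<Sum>r\<in>UNIV. n F a b r *
           (w (u F \<sigma> a b) \<bullet> FEC r (u F \<sigma> a b) (Uout F \<sigma> (a, b)) - w (u F \<sigma> a b) \<bullet> f r (u F \<sigma> a b)))))"
    by (simp only: sum_distrib_left)
  have volume: "inner_NM N M (DN N X FEC U) (\<lambda>\<sigma> q. w (U \<sigma> q)) =
      (\<Sum>\<sigma>\<le>M. lgl_weight M \<sigma> * (\<Sum>F\<in>UNIV. \<Sum>a\<le>N. \<Sum>b\<le>N. lgl_weight N a * lgl_weight N b *
         (\<Sum>r\<in>UNIV. n F a b r * (w (u F \<sigma> a b) \<bullet> f r (u F \<sigma> a b) - \<psi> r (u F \<sigma> a b)))))"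
    unfolding inner_NM_def n_def u_def
    by (intro sum.cong refl arg_cong2[where f = "(*)"] volume_entropy_balance[OF N EC] U) auto
  show ?thesis
    unfolding A_S_def surface volume distrib_left[symmetric] sum.distrib[symmetric]
    by (simp add: n_def u_def flip: distrib_left)
qed

theorem theorem1:
  fixes A :: "(real^'p) set"
    and f :: "3 \<Rightarrow> real^'p \<Rightarrow> real^'p"
    and s :: "real^'p \<Rightarrow> real"
    and w :: "real^'p \<Rightarrow> real^'p"
    and fs :: "3 \<Rightarrow> real^'p \<Rightarrow> real"
    and Us :: "real^'p \<Rightarrow> real^'p \<Rightarrow> real^'p"
    and FEC :: "3 \<Rightarrow> real^'p \<Rightarrow> real^'p \<Rightarrow> real^'p"
    and N M KT KS :: nat
    and T :: real
    and t :: "nat \<Rightarrow> real"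
    and \<Omega> :: "(real^3) set"
    and X :: "nat \<Rightarrow> real^3 \<Rightarrow> real^3"
    and nb :: "nat \<times> face \<Rightarrow> nat \<times> face"
    and orient :: "nat \<times> face \<Rightarrow> square_sym"
    and shift :: "nat \<times> face \<Rightarrow> real^3"
    and U :: "nat \<Rightarrow> nat \<Rightarrow> 'p st_field"
    and u0 :: "nat \<Rightarrow> 'p space_field"
    and UL UR :: "nat \<Rightarrow> nat \<Rightarrow> 'p space_field"
    and Fstar :: "nat \<Rightarrow> nat \<Rightarrow> face \<Rightarrow> nat \<Rightarrow> nat \<times> nat \<Rightarrow> real^'p"
  assumes "N \<ge> 1" "M \<ge> 1" "KT \<ge> 1" "KS \<ge> 1"
    and "entropy_system A f s w fs"
    and "two_point A w (\<lambda>u. u) (Phi s w) Us"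
    and "\<And>m. two_point A w (f m) (Psi f w fs m) (FEC m)"
    and "time_mesh T KT t"
    and "periodic_mesh N \<Omega> KS X nb orient shift"
    and "\<And>n k \<sigma> q. \<lbrakk>n \<in> {1..KT}; k \<in> {1..KS}; \<sigma> \<le> M; q \<in> idxs N\<rbrakk> \<Longrightarrow> U n k \<sigma> q \<in> A"
    and "\<And>k q. \<lbrakk>k \<in> {1..KS}; q \<in> idxs N\<rbrakk> \<Longrightarrow> u0 k q \<in> A"
    and "dgsem_solution N M KT KS t X f Us FEC UL UR Fstar U"
    and "\<And>n k q. \<lbrakk>n \<in> {1..KT}; k \<in> {1..KS}; q \<in> idxs N\<rbrakk> \<Longrightarrow> UR n k q = U n k M q"
    and "\<And>n k q. \<lbrakk>n \<in> {1..KT}; k \<in> {1..KS}; q \<in> idxs N\<rbrakk> \<Longrightarrow> UL n k q = past_state M u0 U n k q"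
    and "\<And>n k q. \<lbrakk>n \<in> {1..KT}; k \<in> {1..KS}; q \<in> idxs N\<rbrakk> \<Longrightarrow>
           (w (U n k 0 q) - w (past_state M u0 U n k q)) \<bullet> UL n k q
             \<le> Phi s w (U n k 0 q) - Phi s w (past_state M u0 U n k q)"
    and "\<And>n k F \<sigma> a b. \<lbrakk>n \<in> {1..KT}; k \<in> {1..KS}; \<sigma> \<le> M; a \<le> N; b \<le> N\<rbrakk> \<Longrightarrow>
           Fstar n k F \<sigma> (a, b) =
             normal_flux N (X k) F (face_node N F (a, b))
               (\<lambda>m. FEC m (U n k \<sigma> (face_node N F (a, b))) (outer_state N nb orient U n k F \<sigma> (a, b)))"
  shows "total_entropy N KS X s (\<lambda>k. U KT k M) \<le> total_entropy N KS X s u0"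
proof -
  note N = assms(1) and M = assms(2) and Us = assms(6) and EC = assms(7) and mesh = assms(9)
    and U = assms(10) and sol = assms(12) and UR = assms(13) and UL = assms(14)
    and jump = assms(15) and Fstar = assms(16)
  let ?E = "total_entropy N KS X s"
  have step: "?E (\<lambda>k. U n k M) \<le> ?E (past_state M u0 U n)" if n: "n \<in> {1..KT}" for n
  proof -
    define B where "B \<sigma> k = (\<Sum>F\<in>UNIV. \<Sum>a\<le>N. \<Sum>b\<le>N. lgl_weight N a * lgl_weight N b *
      (\<Sum>r\<in>UNIV. scaled_normal N (X k) F (face_node N F (a, b)) $ r *
        (w (U n k \<sigma> (face_node N F (a, b))) \<bullet> FEC r (U n k \<sigma> (face_node N F (a, b)))
            (outer_state N nb orient U n k F \<sigma> (a, b)) -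
         Psi f w fs r (U n k \<sigma> (face_node N F (a, b))))))" for \<sigma> k
    have AS: "A_S N M (X k) (t n - t (n - 1)) f FEC (Fstar n k) (U n k) (\<lambda>\<sigma> q. w (U n k \<sigma> q)) =
        (t n - t (n - 1)) / 2 * (\<Sum>\<sigma>\<le>M. lgl_weight M \<sigma> * B \<sigma> k)" if k: "k \<in> {1..KS}" for k
      unfolding B_def
      by (rule A_S_entropy[OF N EC U[OF n k] Fstar[OF n k]])
    have "(\<Sum>k=1..KS. B \<sigma> k) = 0" if "\<sigma> \<le> M" for \<sigma>
      unfolding B_def outer_state_def
      by (rule interface_sum_zero[OF N mesh EC, where V = "\<lambda>k. U n k \<sigma>"]) (intro U n that; assumption)
    hence "(\<Sum>\<sigma>\<le>M. lgl_weight M \<sigma> * (\<Sum>k=1..KS. B \<sigma> k)) = 0" by simp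
    hence B0: "(\<Sum>k=1..KS. \<Sum>\<sigma>\<le>M. lgl_weight M \<sigma> * B \<sigma> k) = 0"
      by (subst sum.swap) (simp add: sum_distrib_left)
    have "(\<Sum>k=1..KS. A_S N M (X k) (t n - t (n - 1)) f FEC (Fstar n k) (U n k) (\<lambda>\<sigma> q. w (U n k \<sigma> q))) =
        (\<Sum>k=1..KS. (t n - t (n - 1)) / 2 * (\<Sum>\<sigma>\<le>M. lgl_weight M \<sigma> * B \<sigma> k))"
      by (rule sum.cong[OF refl AS])
    also have "\<dots> = 0"
      by (simp only: sum_distrib_left[symmetric] B0 mult_zero_right)
    finally have AS0: "(\<Sum>k=1..KS. A_S N M (X k) (t n - t (n - 1)) f FEC (Fstar n k) (U n k)
        (\<lambda>\<sigma> q. w (U n k \<sigma> q))) = 0" .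
    define AT where "AT k = A_T N M (Jac N (X k)) Us (UL n k) (UR n k) (U n k) (\<lambda>\<sigma> q. w (U n k \<sigma> q))" for k
    have "AT k + A_S N M (X k) (t n - t (n - 1)) f FEC (Fstar n k) (U n k) (\<lambda>\<sigma> q. w (U n k \<sigma> q)) = 0"
      if "k \<in> {1..KS}" for k
      using sol n that unfolding dgsem_solution_def AT_def by blast
    hence "(\<Sum>k=1..KS. AT k + A_S N M (X k) (t n - t (n - 1)) f FEC (Fstar n k) (U n k) (\<lambda>\<sigma> q. w (U n k \<sigma> q))) = 0"
      by (intro sum.neutral) blast
    hence AT0: "(\<Sum>k=1..KS. AT k) = 0" using AS0 by (simp add: sum.distrib)
    have "(\<Sum>q\<in>idxs N. weight3 N q * Jac N (X k) q * s (U n k M q)) -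
        (\<Sum>q\<in>idxs N. weight3 N q * Jac N (X k) q * s (past_state M u0 U n k q)) \<le> AT k"
      if k: "k \<in> {1..KS}" for k
    proof -
      have pos: "weight3 N q * Jac N (X k) q \<ge> 0" if "q \<in> idxs N" for q
      proof -
        have "weight3 N q \<ge> 0"
          using that lgl_weight_nonneg[OF N] by (cases q) (auto simp: idxs_def)
        moreover have "Jac N (X k) q > 0"
          using mesh k that unfolding periodic_mesh_def by blast
        ultimately show ?thesis by simp
      qed
      \<comment> \<open>\<open>UL\<close> is the past state \<open>v\<close>, and \<open>w(v) \<bullet> v - \<Phi>(v) = s(v)\<close>.\<close>
      have up: "w (U n k 0 q) \<bullet> UL n k q - Phi s w (U n k 0 q) \<le> s (past_state M u0 U n k q)"
        if q: "q \<in> idxs N" for q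
        using jump[OF n k q] UL[OF n k q] by (simp add: Phi_def inner_diff_left)
      have "AT k = (\<Sum>q\<in>idxs N. weight3 N q * Jac N (X k) q *
          (s (U n k M q) - (w (U n k 0 q) \<bullet> UL n k q - Phi s w (U n k 0 q))))"
        unfolding AT_def by (rule A_T_entropy[OF M Us, where U = "U n k", OF U[OF n k] UR[OF n k]])
      moreover have "(\<Sum>q\<in>idxs N. weight3 N q * Jac N (X k) q *
            (s (U n k M q) - s (past_state M u0 U n k q))) \<le>
          (\<Sum>q\<in>idxs N. weight3 N q * Jac N (X k) q *
            (s (U n k M q) - (w (U n k 0 q) \<bullet> UL n k q - Phi s w (U n k 0 q))))"
        by (intro sum_mono mult_left_mono diff_left_mono pos up)
      ultimately show ?thesis by (simp add: right_diff_distrib sum_subtractf)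
    qed
    hence "?E (\<lambda>k. U n k M) - ?E (past_state M u0 U n) \<le> (\<Sum>k=1..KS. AT k)"
      unfolding total_entropy_def sum_subtractf[symmetric] by (intro sum_mono) blast
    thus ?thesis using AT0 by simp
  qed
  have "?E (\<lambda>k. U n k M) \<le> ?E u0" if "1 \<le> n" "n \<le> KT" for n
    using that
  proof (induction n rule: nat_induct_at_least)
    case base
    thus ?case using step[of 1] by (simp add: past_state_def[abs_def])
  next
    case (Suc n)
    thus ?case using step[of "Suc n"] by (simp add: past_state_def[abs_def])
  qed
  thus ?thesis using assms(3) by blast
qed

end
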